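(* For a positive integer $k$, set $\varphi_{k}:=\sum_{a=2}^{k}(-\hbar)^{k-a}z_{a}+(-\hbar)^{k-1}\xi$. Let $r$ be a positive integer and let $\alpha_{i},\beta_{i}$ $(1\le i\le r)$ be non-negative integers. Then $$\bar{Z}_{q}\big(\varphi_{\alpha_{1}+1}\rho^{\beta_{1}}\cdots\varphi_{\alpha_{r}+1}\rho^{\beta_{r}}\big)=\bar{Z}_{q}\big(\varphi_{\beta_{r}+1}\rho^{\alpha_{r}}\cdots\varphi_{\beta_{1}+1}\rho^{\alpha_{1}}\big).$$
   Context: Fix a complex number $q$ with $0<|q|<1$ and set $[n]:=\frac{1-q^{n}}{1-q}$ for $n\ge 1$. Let $\hbar$ be a formal variable, $\mathcal{C}:=\mathbb{Q}[\hbar]$, and let $\mathfrak{H}$ be the non-commutative polynomial algebra over $\mathcal{C}$ freely generated by $x,y,\rho$. Set $\xi:=y-\rho$ and $z_{k}:=x^{k-1}y$ $(k\ge1)$; thus $\rho=z_{1}-\xi$. Let $\mathfrak{H}^{1}$ be the subalgebra of $\mathfrak{H}$ (freely) generated by the set $A:=\{\xi\}\cup\{z_{k}\}_{k\ge1}$, and let $\widehat{\mathfrak{H}}^{0}:=\mathcal{C}+\xi\mathfrak{H}^{1}+\sum_{k\ge2}z_{k}\mathfrak{H}^{1}$, a $\mathcal{C}$-submodule of $\mathfrak{H}^1$. $\mathbb{C}$ is regarded as a $\mathcal{C}$-module with $\hbar$ acting as multiplication by $1-q$. Let $\mathfrak{z}$ be the $\mathcal{C}$-submodule of $\mathfrak{H}$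 generated by $A$. For $n\ge1$ let $u\mapsto I_{u}(n)$ be the $\mathcal{C}$-linear map $\mathfrak{z}\to\mathbb{C}$ with $I_{\xi}(n)=\frac{q^{n}}{[n]}$ and $I_{z_{k}}(n)=\frac{q^{(k-1)n}}{[n]^{k}}$. The $\mathcal{C}$-linear map $Z_{q}:\widehat{\mathfrak{H}}^{0}\to\mathbb{C}$ is defined by $Z_{q}(1)=1$ and, for a word $u_{1}\cdots u_{r}\in\widehat{\mathfrak{H}}^{0}$ with $r\ge1$, $u_{i}\in A$, by the absolutely convergent sum $Z_{q}(u_{1}\cdots u_{r})=\sum_{n_{1}>\cdots>n_{r}>0}\prod_{i=1}^{r}I_{u_{i}}(n_{i})$. Weight: $\widehat{\mathfrak{H}}^{0}$ is a graded $\mathbb{Q}$-module by giving each of $x,y,\rho$ and $\hbar$ degree one; $\widehat{\mathfrak{H}}^{0}_{d}$ is the homogeneous component of degree (weight) $d$. The $\mathbb{Q}$-linear map $\bar{Z}_{q}:\widehat{\mathfrak{H}}^{0}\to\mathbb{C}$ is defined by $\bar{Z}_{q}(w):=(1-q)^{-d}Z_{q}(w)$ for $w\in\widehat{\mathfrak{H}}^{0}_{d}$. *)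

theory Defs
  imports
    "HOL-Analysis.Analysis"
    "HOL-Library.Poly_Mapping"
    "HOL-Computational_Algebra.Polynomial"
begin

subsection \<open>The algebra \<open>\<HH>\<close> and its subspaces\<close>

text \<open>Finitely supported functions on a (additively written) monoid carry the convolution
  product in \<^theory>\<open>HOL-Library.Poly_Mapping\<close>.  Taking the monoid to be the
  free monoid on three generators and the coefficients to be \<open>\<rat>[\<hbar>]\<close> gives the free
  algebra.\<close>

datatype 'a free_monoid = Word (letters: "'a list")

instantiation free_monoid :: (type) monoid_add
begin
definition zero_free_monoid :: "'a free_monoid" where "0 = Word []"
definition plus_free_monoid :: "'a free_monoid \<Rightarrow> 'a free_monoid \<Rightarrow> 'a free_monoid"
  where "u + v = Word (letters u @ letters v)"
instance
  by standard (simp_all add: zero_free_monoid_def plus_free_monoid_def)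
end

datatype gen = GX | GY | GRho

type_synonym alg = "gen free_monoid \<Rightarrow>\<^sub>0 rat poly"

definition gen_elem :: "gen \<Rightarrow> alg"
  where "gen_elem g = Poly_Mapping.single (Word [g]) 1"

definition scal :: "rat poly \<Rightarrow> alg"
  where "scal c = Poly_Mapping.single 0 c"

definition hbar :: alg where "hbar = scal [:0, 1:]"
definition gen_x :: alg where "gen_x = gen_elem GX"
definition gen_y :: alg where "gen_y = gen_elem GY"
definition rho :: alg where "rho = gen_elem GRho"
definition xi :: alg where "xi = gen_y - rho"

definition zgen :: "nat \<Rightarrow> alg"  \<comment> \<open>meaningful for \<open>k \<ge> 1\<close>\<close>
  where "zgen k = gen_x ^ (k - 1) * gen_y"

inductive_set H1 :: "alg set" where
  H1_scal: "scal c \<in> H1"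
| H1_xi: "xi \<in> H1"
| H1_z: "k \<ge> 1 \<Longrightarrow> zgen k \<in> H1"
| H1_add: "a \<in> H1 \<Longrightarrow> b \<in> H1 \<Longrightarrow> a + b \<in> H1"
| H1_mult: "a \<in> H1 \<Longrightarrow> b \<in> H1 \<Longrightarrow> a * b \<in> H1"

definition H0hat :: "alg set"
  where "H0hat = {scal c + xi * a + (\<Sum>k = 2..N. zgen k * b k) | c a N b.
                   a \<in> H1 \<and> (\<forall>k. b k \<in> H1)}"

subsection \<open>Words in the free generators of \<open>\<HH>\<^sup>1\<close>\<close>

text \<open>\<open>LZ k\<close> stands for \<open>z\<close> with index \<open>k + 1\<close>, so that \<open>letter\<close> is in bijection with
  the set of free generators \<open>\<xi>, z\<^sub>1, z\<^sub>2, \<dots>\<close>.\<close>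

datatype letter = LXi | LZ nat

fun letter_elem :: "letter \<Rightarrow> alg" where
  "letter_elem LXi = xi"
| "letter_elem (LZ k) = zgen (Suc k)"

definition word_elem :: "letter list \<Rightarrow> alg"
  where "word_elem w = prod_list (map letter_elem w)"

definition lincomb :: "(letter list \<Rightarrow>\<^sub>0 rat poly) \<Rightarrow> alg"
  where "lincomb c = (\<Sum>w\<in>Poly_Mapping.keys c. scal (Poly_Mapping.lookup c w) * word_elem w)"

text \<open>The coordinates of an element of \<open>\<HH>\<^sup>1\<close> in the basis of words; existence and uniqueness
  are \<open>H1_eq_range_lincomb\<close> and \<open>inj_lincomb\<close> below.\<close>

definition coords :: "alg \<Rightarrow> (letter list \<Rightarrow>\<^sub>0 rat poly)"
  where "coords h = (THE c. h = lincomb c)"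

subsection \<open>The evaluation maps\<close>

definition qint :: "complex \<Rightarrow> nat \<Rightarrow> complex"
  where "qint q n = (1 - q ^ n) / (1 - q)"

fun I_letter :: "complex \<Rightarrow> letter \<Rightarrow> nat \<Rightarrow> complex" where
  "I_letter q LXi n = q ^ n / qint q n"
| "I_letter q (LZ k) n = q ^ (k * n) / qint q n ^ Suc k"

definition decr_tuples :: "nat \<Rightarrow> nat list set"
  where "decr_tuples r = {ns. length ns = r \<and> sorted_wrt (>) ns \<and> (\<forall>n\<in>set ns. n > 0)}"

text \<open>The empty word gives value 1, since the only tuple is the empty one.\<close>

definition Zq_word :: "complex \<Rightarrow> letter list \<Rightarrow> complex"
  where "Zq_word q w =
    (\<Sum>\<^sub>\<infinity>ns\<in>decr_tuples (length w). \<Prod>i<length w. I_letter q (w ! i) (ns ! i))"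

text \<open>The action of \<open>\<rat>[\<hbar>]\<close> on the complex numbers, with \<open>\<hbar>\<close> acting as \<open>1 - q\<close>.\<close>

definition act :: "complex \<Rightarrow> rat poly \<Rightarrow> complex"
  where "act q c = poly (map_poly of_rat c) (1 - q)"

text \<open>Only the values on \<open>H0hat\<close>, where the series converge, are meaningful.  The map is linear
  over \<open>\<rat>[\<hbar>]\<close> with the prescribed values on words: see \<open>Zq_add\<close>, \<open>Zq_scale\<close>, \<open>Zq_one\<close>
  and \<open>Zq_word_elem\<close> below.\<close>

definition Zq :: "complex \<Rightarrow> alg \<Rightarrow> complex"
  where "Zq q h = (\<Sum>w\<in>Poly_Mapping.keys (coords h).
                     act q (Poly_Mapping.lookup (coords h) w) * Zq_word q w)"

subsection \<open>Weight\<close>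

text \<open>The term \<open>\<hbar>\<^sup>i u\<close> with \<open>u\<close> a word in \<open>x, y, \<rho>\<close> has weight \<open>i + |u|\<close>.\<close>

definition homogeneous :: "nat \<Rightarrow> alg \<Rightarrow> bool"
  where "homogeneous d h \<longleftrightarrow>
    (\<forall>u i. coeff (Poly_Mapping.lookup h u) i \<noteq> 0 \<longrightarrow> i + length (letters u) = d)"

definition weight_part :: "nat \<Rightarrow> alg \<Rightarrow> alg"
  where "weight_part d h =
    (\<Sum>u \<in> {u \<in> Poly_Mapping.keys h. length (letters u) \<le> d}.
       Poly_Mapping.single u
         (monom (coeff (Poly_Mapping.lookup h u) (d - length (letters u))) (d - length (letters u))))"

text \<open>The weight components of an element of \<open>H0hat\<close> are again in \<open>H0hat\<close>
  (\<open>weight_part_H0hat\<close>), and \<open>Zq_bar\<close> is the \<open>\<rat>\<close>-linear map with the prescribed values on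
  homogeneous elements (\<open>Zq_bar_homogeneous\<close>, \<open>Zq_bar_add\<close>, \<open>Zq_bar_scale\<close>).\<close>

definition Zq_bar :: "complex \<Rightarrow> alg \<Rightarrow> complex"
  where "Zq_bar q h =
    (\<Sum>d \<in> {d. weight_part d h \<noteq> 0}. inverse ((1 - q) ^ d) * Zq q (weight_part d h))"

definition phi :: "nat \<Rightarrow> alg"  \<comment> \<open>meaningful for \<open>k \<ge> 1\<close>\<close>
  where "phi k = (\<Sum>a = 2..k. (- hbar) ^ (k - a) * zgen a) + (- hbar) ^ (k - 1) * xi"

subsection \<open>Well-definedness\<close>

lemma lookup_single_mult:
  fixes p :: alg
  shows "Poly_Mapping.lookup (Poly_Mapping.single v c * p) (v + k) = c * Poly_Mapping.lookup p k"
proof -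
  have inj: "v + k = v + k' \<longleftrightarrow> k' = k" for k'
    by (cases k; cases k') (auto simp: plus_free_monoid_def)
  have "Poly_Mapping.lookup (Poly_Mapping.single v c * p) (v + k)
      = (\<Sum>l. (c when v = l) * (\<Sum>k'. Poly_Mapping.lookup p k' when v + k = l + k'))"
    by (simp add: lookup_mult lookup_single)
  also have "\<dots> = (\<Sum>l. c * (\<Sum>k'. Poly_Mapping.lookup p k' when v + k = v + k') when l = v)"
    by (rule Sum_any.cong) (auto simp: when_def)
  also have "\<dots> = c * Poly_Mapping.lookup p k"
    by (simp add: inj)
  finally show ?thesis .
qed

lemma lookup_single_mult_neq:
  fixes p :: alg
  assumes "\<And>k'. k \<noteq> v + k'"
  shows "Poly_Mapping.lookup (Poly_Mapping.single v c * p) k = 0"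
proof -
  have "Poly_Mapping.lookup (Poly_Mapping.single v c * p) k
      = (\<Sum>l. (c when v = l) * (\<Sum>k'. Poly_Mapping.lookup p k' when k = l + k'))"
    by (simp add: lookup_mult lookup_single)
  also have "\<dots> = (\<Sum>l. c * (\<Sum>k'. Poly_Mapping.lookup p k' when k = v + k') when l = v)"
    by (rule Sum_any.cong) (auto simp: when_def)
  also have "\<dots> = 0"
    using assms by simp
  finally show ?thesis .
qed

lemma lookup_gen_elem_mult:
  "Poly_Mapping.lookup (gen_elem g * p) (Word (g' # W))
     = (if g = g' then Poly_Mapping.lookup p (Word W) else 0)"
proof (cases "g = g'")
  case True
  then show ?thesis
    using lookup_single_mult[of "Word [g]" 1 p "Word W"]
    by (simp add: gen_elem_def plus_free_monoid_def)
next
  case False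
  then show ?thesis
    unfolding gen_elem_def
    by (subst lookup_single_mult_neq) (auto simp: plus_free_monoid_def)
qed

lemma lookup_gen_elem_mult_Nil: "Poly_Mapping.lookup (gen_elem g * p) (Word []) = 0"
  unfolding gen_elem_def by (rule lookup_single_mult_neq) (simp add: plus_free_monoid_def)

lemma lookup_scal_mult: "Poly_Mapping.lookup (scal c * p) u = c * Poly_Mapping.lookup p u"
  using lookup_single_mult[of 0 c p u] by (simp add: scal_def)

lemma scal_commute: "p * scal c = scal c * p"
proof (rule poly_mapping_eqI)
  fix u
  have "Poly_Mapping.lookup (p * scal c) u
      = (\<Sum>l. Poly_Mapping.lookup p l * (\<Sum>k'. (c when 0 = k') when u = l + k'))"
    by (simp add: lookup_mult lookup_single scal_def)
  also have "\<dots> = (\<Sum>l. Poly_Mapping.lookup p l * c when l = u)"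
  proof -
    have "((c when 0 = k') when u = l + k') = ((c when l = u) when k' = 0)" for l k'
      by (auto simp: when_def)
    then show ?thesis by (simp add: mult_when)
  qed
  also have "\<dots> = Poly_Mapping.lookup (scal c * p) u"
    by (simp add: lookup_scal_mult mult.commute)
  finally show "Poly_Mapping.lookup (p * scal c) u = Poly_Mapping.lookup (scal c * p) u" .
qed

lemma scal_add: "scal (a + b) = scal a + scal b"
  by (simp add: scal_def single_add)

lemma scal_mult: "scal (a * b) = scal a * scal b"
  by (simp add: scal_def mult_single)

lemma scal_mult_scal: "(scal a * p) * (scal b * p') = scal a * (scal b * (p * p'))"
proof -
  have "p * (scal b * p') = scal b * (p * p')"
    by (simp only: mult.assoc[symmetric] scal_commute[of p b])
  then show ?thesis by (simp only: mult.assoc)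
qed

lemma scal_0 [simp]: "scal 0 = 0" and scal_1 [simp]: "scal 1 = 1"
  by (simp_all add: scal_def)

lemma lincomb_superset:
  assumes "finite S" "Poly_Mapping.keys c \<subseteq> S"
  shows "lincomb c = (\<Sum>w\<in>S. scal (Poly_Mapping.lookup c w) * word_elem w)"
  unfolding lincomb_def using assms
  by (intro sum.mono_neutral_left) (auto simp: in_keys_iff)

lemma lincomb_add: "lincomb (c + d) = lincomb c + lincomb d"
proof -
  let ?S = "Poly_Mapping.keys c \<union> Poly_Mapping.keys d"
  have "Poly_Mapping.keys (c + d) \<subseteq> ?S" by (rule Poly_Mapping.keys_add)
  then show ?thesis
    by (simp add: lincomb_superset[of ?S] lookup_add scal_add distrib_right sum.distrib)
qed

lemma lincomb_0 [simp]: "lincomb 0 = 0"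
  by (simp add: lincomb_def)

lemma lincomb_uminus: "lincomb (- c) = - lincomb c"
  by (metis add.right_inverse lincomb_0 lincomb_add minus_unique)

lemma lincomb_single: "lincomb (Poly_Mapping.single w c) = scal c * word_elem w"
  by (cases "c = 0") (simp_all add: lincomb_def)

lemma lincomb_sum: "lincomb (\<Sum>i\<in>S. f i) = (\<Sum>i\<in>S. lincomb (f i))"
  by (induction S rule: infinite_finite_induct) (simp_all add: lincomb_add)

fun lead :: "letter list \<Rightarrow> gen list" where
  "lead [] = []"
| "lead (LXi # w) = GRho # lead w"
| "lead (LZ k # w) = replicate k GX @ GY # lead w"

lemma word_elem_simps [simp]:
  "word_elem [] = 1"
  "word_elem (LXi # w) = xi * word_elem w"
  "word_elem (LZ k # w) = zgen (Suc k) * word_elem w"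
  by (simp_all add: word_elem_def)

lemma word_elem_append: "word_elem (v @ w) = word_elem v * word_elem w"
  by (simp add: word_elem_def)

lemma lookup_xi_mult:
  "Poly_Mapping.lookup (xi * p) (Word (g # W)) =
     (case g of GY \<Rightarrow> Poly_Mapping.lookup p (Word W) | GRho \<Rightarrow> - Poly_Mapping.lookup p (Word W)
        | GX \<Rightarrow> 0)"
  by (cases g) (simp_all add: xi_def gen_y_def rho_def left_diff_distrib lookup_minus lookup_gen_elem_mult)

lemma lookup_xi_mult_Nil: "Poly_Mapping.lookup (xi * p) (Word []) = 0"
  by (simp add: xi_def gen_y_def rho_def left_diff_distrib lookup_minus lookup_gen_elem_mult_Nil)

lemma lookup_zgen_mult:
  "Poly_Mapping.lookup (zgen (Suc k) * p) (Word (replicate j GX @ GY # W)) =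
     (if j = k then Poly_Mapping.lookup p (Word W) else 0)"
proof (induction k arbitrary: j)
  case 0
  then show ?case by (cases j) (simp_all add: zgen_def gen_y_def lookup_gen_elem_mult)
next
  case (Suc k)
  have "zgen (Suc (Suc k)) * p = gen_elem GX * (zgen (Suc k) * p)"
    by (simp add: zgen_def gen_x_def mult.assoc)
  with Suc show ?case
    by (cases j) (simp_all add: lookup_gen_elem_mult)
qed

lemma lookup_zgen_mult_Rho: "Poly_Mapping.lookup (zgen (Suc k) * p) (Word (GRho # W)) = 0"
  by (cases k) (simp_all add: zgen_def gen_x_def gen_y_def lookup_gen_elem_mult mult.assoc)

lemma lookup_zgen_mult_Nil: "Poly_Mapping.lookup (zgen (Suc k) * p) (Word []) = 0"
  by (cases k) (simp_all add: zgen_def gen_x_def gen_y_def lookup_gen_elem_mult_Nil mult.assoc)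

lemma lookup_word_elem_lead:
  "(Poly_Mapping.lookup (word_elem u) (Word (lead v)) \<noteq> 0 \<longrightarrow>
      u = v \<or> count_list u LXi > count_list v LXi)
   \<and> Poly_Mapping.lookup (word_elem v) (Word (lead v)) \<noteq> 0"
proof (induction v arbitrary: u)
  case Nil
  have "Poly_Mapping.lookup (1 :: alg) (Word []) \<noteq> 0"
    by (simp add: zero_free_monoid_def[symmetric])
  moreover have "Poly_Mapping.lookup (word_elem u) (Word []) = 0" if "u \<noteq> []"
    using that by (cases u rule: lead.cases) (simp_all add: lookup_xi_mult_Nil lookup_zgen_mult_Nil)
  ultimately show ?case by auto
next
  case (Cons l v)
  have one: "Poly_Mapping.lookup (1 :: alg) (Word (g # W)) = 0" for g W
    by (simp add: lookup_one zero_free_monoid_def)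
  have xz: "Poly_Mapping.lookup (xi * p) (Word (replicate j GX @ GY # W)) =
              (if j = 0 then Poly_Mapping.lookup p (Word W) else 0)" for p j W
    by (cases j) (simp_all add: lookup_xi_mult)
  have oz: "Poly_Mapping.lookup (1 :: alg) (Word (replicate j GX @ GY # W)) = 0" for j W
    by (cases j) (simp_all add: one)
  have IH: "u = v \<or> count_list v LXi < count_list u LXi"
    if "Poly_Mapping.lookup (word_elem u) (Word (lead v)) \<noteq> 0" for u
    using Cons that by blast
  have IH2: "Poly_Mapping.lookup (word_elem v) (Word (lead v)) \<noteq> 0"
    using Cons by blast
  show ?case
  proof (cases l)
    case LXi
    then show ?thesis using IH IH2
      by (cases u rule: lead.cases)
         (auto simp: one lookup_xi_mult lookup_zgen_mult_Rho)
  next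
    case (LZ k)
    then show ?thesis using IH IH2
      by (cases u rule: lead.cases)
         (auto simp: oz xz lookup_zgen_mult split: if_splits dest!: IH)
  qed
qed

lemma lincomb_eq_0_imp: "lincomb c = 0 \<Longrightarrow> c = 0"
proof (rule ccontr)
  assume 0: "lincomb c = 0" and "c \<noteq> 0"
  then have "Poly_Mapping.keys c \<noteq> {}"
    using poly_mapping_eqI[of c 0] by (auto simp: in_keys_iff)
  then have "Max ((\<lambda>u. count_list u LXi) ` Poly_Mapping.keys c)
      \<in> (\<lambda>u. count_list u LXi) ` Poly_Mapping.keys c"
    by (intro Max_in) auto
  then obtain v where v: "v \<in> Poly_Mapping.keys c"
    and "Max ((\<lambda>u. count_list u LXi) ` Poly_Mapping.keys c) = count_list v LXi"
    by auto
  then have max: "count_list u LXi \<le> count_list v LXi" if "u \<in> Poly_Mapping.keys c" for u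
    using that by (metis Max_ge finite_imageI finite_keys image_eqI)
  have "Poly_Mapping.lookup (word_elem u) (Word (lead v)) = 0"
    if "u \<in> Poly_Mapping.keys c" "u \<noteq> v" for u
    using lookup_word_elem_lead[of u v] max[OF that(1)] that(2) by auto
  then have "Poly_Mapping.lookup (lincomb c) (Word (lead v))
      = (\<Sum>u\<in>Poly_Mapping.keys c. if u = v then
           Poly_Mapping.lookup c v * Poly_Mapping.lookup (word_elem v) (Word (lead v)) else 0)"
    unfolding lincomb_def lookup_sum by (intro sum.cong) (auto simp: lookup_scal_mult)
  also have "\<dots> = Poly_Mapping.lookup c v * Poly_Mapping.lookup (word_elem v) (Word (lead v))"
    using v by simp
  also have "\<dots> \<noteq> 0"
    using v lookup_word_elem_lead[of v v] by (simp add: in_keys_iff)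
  finally show False using 0 by simp
qed

lemma inj_lincomb: "inj lincomb"
proof (rule injI)
  fix c d assume "lincomb c = lincomb d"
  then have "lincomb (c + - d) = 0" by (simp only: lincomb_add lincomb_uminus) simp
  from lincomb_eq_0_imp[OF this] show "c = d" by simp
qed

lemma coords_lincomb [simp]: "coords (lincomb c) = c"
  unfolding coords_def using inj_lincomb by (auto dest: injD)

lemma H1_minus: "a \<in> H1 \<Longrightarrow> - a \<in> H1"
  using H1_mult[OF H1_scal[of "-1"], of a] by (simp add: scal_def single_uminus)

lemma H1_0 [simp]: "0 \<in> H1" and H1_1 [simp]: "1 \<in> H1"
  using H1_scal[of 0] H1_scal[of 1] by simp_all

lemma H1_sum: "(\<And>i. i \<in> S \<Longrightarrow> f i \<in> H1) \<Longrightarrow> (\<Sum>i\<in>S. f i) \<in> H1"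
  by (induction S rule: infinite_finite_induct) (auto intro: H1_add)

lemma H1_power: "a \<in> H1 \<Longrightarrow> a ^ n \<in> H1"
  by (induction n) (auto intro: H1_mult)

lemma word_elem_H1: "word_elem w \<in> H1"
  by (induction w rule: lead.induct) (auto intro!: H1_mult H1_xi H1_z)

lemma range_lincomb_scale: "a \<in> range lincomb \<Longrightarrow> scal p * a \<in> range lincomb"
proof -
  assume "a \<in> range lincomb"
  then obtain c where c: "a = lincomb c" by auto
  have "scal p * a = lincomb (\<Sum>w\<in>Poly_Mapping.keys c. Poly_Mapping.single w (p * Poly_Mapping.lookup c w))"
    by (simp add: c lincomb_sum lincomb_single sum_distrib_left scal_mult mult.assoc lincomb_def[of c])
  then show ?thesis by blast
qed

lemma range_lincomb_sum:
  "(\<And>i. i \<in> S \<Longrightarrow> f i \<in> range lincomb) \<Longrightarrow> (\<Sum>i\<in>S. f i) \<in> range lincomb"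
proof (induction S rule: infinite_finite_induct)
  case (insert i S)
  then have "f i \<in> range lincomb" "(\<Sum>i\<in>S. f i) \<in> range lincomb" by auto
  with insert.hyps show ?case by (auto simp: lincomb_add[symmetric])
qed (auto intro: range_eqI[of _ _ 0])

lemma H1_eq_range_lincomb: "H1 = range lincomb"
proof (intro equalityI subsetI)
  fix h assume "h \<in> range lincomb"
  then show "h \<in> H1"
    by (auto simp: lincomb_def intro!: H1_sum H1_mult H1_scal word_elem_H1)
next
  have we: "word_elem w \<in> range lincomb" for w
    using lincomb_single[of w 1] by (metis mult_1 rangeI scal_1)
  fix h assume "h \<in> H1"
  then show "h \<in> range lincomb"
  proof induction
    case (H1_scal c)
    then show ?case using range_lincomb_scale[OF we[of "[]"], of c] by simp
  next
    case H1_xi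
    then show ?case using we[of "[LXi]"] by simp
  next
    case (H1_z k)
    then show ?case using we[of "[LZ (k - 1)]"] by simp
  next
    case (H1_add a b)
    then show ?case by (auto simp: lincomb_add[symmetric])
  next
    case (H1_mult a b)
    then obtain c d where "a = lincomb c" "b = lincomb d" by auto
    have "a * b = (\<Sum>v\<in>Poly_Mapping.keys c. \<Sum>w\<in>Poly_Mapping.keys d.
        scal (Poly_Mapping.lookup c v) * (scal (Poly_Mapping.lookup d w) * word_elem (v @ w)))"
      unfolding \<open>a = lincomb c\<close> \<open>b = lincomb d\<close> lincomb_def sum_product word_elem_append
      by (intro sum.cong refl scal_mult_scal)
    then show ?case
      by (simp only:) (intro range_lincomb_sum range_lincomb_scale we)
  qed
qed

lemma act_add: "act q (a + b) = act q a + act q b"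
  and act_mult: "act q (a * b) = act q a * act q b"
  and act_0 [simp]: "act q 0 = 0"
  and act_1 [simp]: "act q 1 = 1"
  and act_hbar: "act q [:0, 1:] = 1 - q"
proof -
  have "map_poly of_rat (a + b) = (map_poly of_rat a + map_poly of_rat b :: complex poly)"
    by (rule poly_eqI) (simp add: coeff_map_poly of_rat_add)
  then show "act q (a + b) = act q a + act q b" by (simp add: act_def)
  have "map_poly of_rat (a * b) = (map_poly of_rat a * map_poly of_rat b :: complex poly)"
    by (rule poly_eqI) (simp add: coeff_map_poly coeff_mult of_rat_sum of_rat_mult)
  then show "act q (a * b) = act q a * act q b" by (simp add: act_def)
qed (simp_all add: act_def map_poly_pCons)

lemma Zq_lincomb_superset:
  assumes "finite S" "Poly_Mapping.keys c \<subseteq> S"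
  shows "Zq q (lincomb c) = (\<Sum>w\<in>S. act q (Poly_Mapping.lookup c w) * Zq_word q w)"
  unfolding Zq_def coords_lincomb using assms
  by (intro sum.mono_neutral_left) (auto simp: in_keys_iff)

lemma Zq_add:
  assumes "a \<in> H1" "b \<in> H1"
  shows "Zq q (a + b) = Zq q a + Zq q b"
proof -
  obtain c d where cd: "a = lincomb c" "b = lincomb d"
    using assms by (auto simp: H1_eq_range_lincomb)
  let ?S = "Poly_Mapping.keys c \<union> Poly_Mapping.keys d"
  have "Poly_Mapping.keys (c + d) \<subseteq> ?S" by (rule Poly_Mapping.keys_add)
  then have "Zq q (lincomb (c + d)) = Zq q (lincomb c) + Zq q (lincomb d)"
    by (simp add: Zq_lincomb_superset[of ?S] lookup_add act_add distrib_right sum.distrib)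
  then show ?thesis by (simp add: cd lincomb_add)
qed

lemma Zq_scale:
  assumes "a \<in> H1"
  shows "Zq q (scal p * a) = act q p * Zq q a"
proof -
  obtain c where c: "a = lincomb c"
    using assms by (auto simp: H1_eq_range_lincomb)
  define d where "d = Poly_Mapping.map ((*) p) c"
  have l: "Poly_Mapping.lookup d w = p * Poly_Mapping.lookup c w" for w
    by (simp add: d_def Poly_Mapping.map.rep_eq when_def)
  have sub: "Poly_Mapping.keys d \<subseteq> Poly_Mapping.keys c"
    by (auto simp: in_keys_iff l)
  have "scal p * a = lincomb d"
    unfolding c lincomb_superset[OF finite_keys sub] lincomb_superset[OF finite_keys order_refl, of c]
      sum_distrib_left by (simp add: l scal_mult mult.assoc)
  then show ?thesis
    unfolding c by (simp only: Zq_lincomb_superset[OF finite_keys sub]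
        Zq_lincomb_superset[OF finite_keys order_refl, of _ c]) (simp add: l act_mult sum_distrib_left mult.assoc)
qed

lemma Zq_word_elem: "Zq q (word_elem w) = Zq_word q w"
proof -
  have "word_elem w = lincomb (Poly_Mapping.single w 1)" by (simp add: lincomb_single)
  then show ?thesis by (simp add: Zq_def)
qed

lemma Zq_one: "Zq q 1 = 1"
proof -
  have "decr_tuples 0 = {[]}" by (auto simp: decr_tuples_def)
  then have "Zq_word q [] = 1" by (simp add: Zq_word_def)
  then show ?thesis using Zq_word_elem[of q "[]"] by simp
qed

subsection \<open>The grading\<close>

lemma lookup_weight_part:
  "Poly_Mapping.lookup (weight_part d h) u =
     (if length (letters u) \<le> d
      then monom (coeff (Poly_Mapping.lookup h u) (d - length (letters u))) (d - length (letters u))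
      else 0)"
proof -
  let ?f = "\<lambda>v. monom (coeff (Poly_Mapping.lookup h v) (d - length (letters v))) (d - length (letters v))"
  let ?S = "{v \<in> Poly_Mapping.keys h. length (letters v) \<le> d}"
  have "Poly_Mapping.lookup (weight_part d h) u = (\<Sum>v\<in>?S. if v = u then ?f v else 0)"
    unfolding weight_part_def lookup_sum by (intro sum.cong) (auto simp: lookup_single when_def)
  also have "\<dots> = (if u \<in> ?S then ?f u else 0)"
    by simp
  finally show ?thesis by (auto simp: in_keys_iff)
qed

lemma weight_part_add: "weight_part d (a + b) = weight_part d a + weight_part d b"
  by (rule poly_mapping_eqI) (simp add: lookup_weight_part lookup_add add_monom)

lemma weight_part_0 [simp]: "weight_part d 0 = 0"
  by (rule poly_mapping_eqI) (simp add: lookup_weight_part)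

lemma weight_part_sum: "weight_part d (\<Sum>i\<in>S. f i) = (\<Sum>i\<in>S. weight_part d (f i))"
  by (induction S rule: infinite_finite_induct) (simp_all add: weight_part_add)

lemma homogeneous_weight_part: "homogeneous d (weight_part d h)"
  by (auto simp: homogeneous_def lookup_weight_part split: if_splits)

lemma weight_part_homogeneous:
  assumes "homogeneous e h"
  shows "weight_part d h = (if d = e then h else 0)"
proof (intro poly_mapping_eqI poly_eqI)
  fix u n
  have "coeff (Poly_Mapping.lookup h u) n = 0" if "n + length (letters u) \<noteq> e" for n
    using assms that by (auto simp: homogeneous_def)
  then show "coeff (Poly_Mapping.lookup (weight_part d h) u) n
      = coeff (Poly_Mapping.lookup (if d = e then h else 0) u) n"
    by (cases "n + length (letters u) = d") (auto simp: lookup_weight_part)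
qed

lemma ex_weight_bound: "\<exists>N. \<forall>d>N. weight_part d h = 0"
proof -
  let ?f = "\<lambda>u. length (letters u) + Polynomial.degree (Poly_Mapping.lookup h u)"
  have "weight_part d h = 0" if "d > (\<Sum>u\<in>Poly_Mapping.keys h. ?f u)" for d
  proof (intro poly_mapping_eqI)
    fix u
    show "Poly_Mapping.lookup (weight_part d h) u = Poly_Mapping.lookup 0 u"
    proof (cases "u \<in> Poly_Mapping.keys h")
      case True
      then have "?f u \<le> (\<Sum>u\<in>Poly_Mapping.keys h. ?f u)"
        by (intro member_le_sum) auto
      then have "coeff (Poly_Mapping.lookup h u) (d - length (letters u)) = 0"
        using that by (intro coeff_eq_0) linarith
      then show ?thesis by (simp add: lookup_weight_part)
    next
      case False
      then show ?thesis by (simp add: lookup_weight_part in_keys_iff)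
    qed
  qed
  then show ?thesis by blast
qed

lemma finite_weights: "finite {d. weight_part d h \<noteq> 0}"
proof -
  obtain N where "\<forall>d>N. weight_part d h = 0" using ex_weight_bound by blast
  then have "{d. weight_part d h \<noteq> 0} \<subseteq> {..N}" by (force simp: not_less)
  then show ?thesis by (rule finite_subset) simp
qed

lemma weight_decomposition: "h = (\<Sum>d | weight_part d h \<noteq> 0. weight_part d h)"
proof (intro poly_mapping_eqI poly_eqI)
  fix u :: "gen free_monoid" and n
  let ?l = "length (letters u)" and ?S = "{d. weight_part d h \<noteq> 0}"
  have "coeff (Poly_Mapping.lookup (\<Sum>d\<in>?S. weight_part d h) u) n
      = (\<Sum>d\<in>?S. if d = n + ?l then coeff (Poly_Mapping.lookup h u) n else 0)"
    unfolding lookup_sum coeff_sum by (intro sum.cong) (auto simp: lookup_weight_part)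
  also have "\<dots> = (if n + ?l \<in> ?S then coeff (Poly_Mapping.lookup h u) n else 0)"
    using finite_weights by simp
  also have "\<dots> = coeff (Poly_Mapping.lookup h u) n"
  proof (cases "n + ?l \<in> ?S")
    case False
    then have "coeff (Poly_Mapping.lookup (weight_part (n + ?l) h) u) n = 0" by simp
    then show ?thesis by (simp add: lookup_weight_part)
  qed simp
  finally show "coeff (Poly_Mapping.lookup h u) n
      = coeff (Poly_Mapping.lookup (\<Sum>d\<in>?S. weight_part d h) u) n" by simp
qed

lemma letters_0 [simp]: "letters 0 = []"
  by (simp add: zero_free_monoid_def)

lemma homogeneous_0: "homogeneous d 0"
  by (simp add: homogeneous_def)

lemma homogeneous_add: "homogeneous d a \<Longrightarrow> homogeneous d b \<Longrightarrow> homogeneous d (a + b)"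
  unfolding homogeneous_def lookup_add coeff_add by (metis add.right_neutral)

lemma homogeneous_diff: "homogeneous d a \<Longrightarrow> homogeneous d b \<Longrightarrow> homogeneous d (a - b)"
  unfolding homogeneous_def lookup_minus coeff_diff by (metis diff_zero)

lemma homogeneous_uminus: "homogeneous d a \<Longrightarrow> homogeneous d (- a)"
  using homogeneous_diff[OF homogeneous_0] by simp

lemma homogeneous_sum: "(\<And>i. i \<in> S \<Longrightarrow> homogeneous d (f i)) \<Longrightarrow> homogeneous d (\<Sum>i\<in>S. f i)"
  by (induction S rule: infinite_finite_induct) (auto intro: homogeneous_0 homogeneous_add)

lemma homogeneous_single_monom: "homogeneous (i + length (letters u)) (Poly_Mapping.single u (monom c i))"
  by (auto simp: homogeneous_def lookup_single when_def)

lemma homogeneous_mult: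
  assumes "homogeneous d a" "homogeneous e b"
  shows "homogeneous (d + e) (a * b)"
proof -
  define f where "f d h u = Poly_Mapping.single u
    (monom (coeff (Poly_Mapping.lookup h u) (d - length (letters u))) (d - length (letters u)))"
    for d and h :: alg and u
  let ?S = "\<lambda>d h. {u \<in> Poly_Mapping.keys h. length (letters u) \<le> d}"
  have eq: "h = (\<Sum>u\<in>?S d h. f d h u)" if "homogeneous d h" for d and h :: alg
    using weight_part_homogeneous[OF that, of d] by (simp add: weight_part_def f_def)
  have "homogeneous (d + e) (f d a u * f e b v)" if "u \<in> ?S d a" "v \<in> ?S e b" for u v
  proof -
    have "(d - length (letters u)) + (e - length (letters v)) + length (letters (u + v)) = d + e"
      using that by (simp add: plus_free_monoid_def)
    then show ?thesis
      using homogeneous_single_monom[of "(d - length (letters u)) + (e - length (letters v))" "u + v"]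
      by (simp add: f_def mult_single mult_monom)
  qed
  then have "homogeneous (d + e) (\<Sum>u\<in>?S d a. \<Sum>v\<in>?S e b. f d a u * f e b v)"
    by (intro homogeneous_sum)
  also have "(\<Sum>u\<in>?S d a. \<Sum>v\<in>?S e b. f d a u * f e b v)
      = (\<Sum>u\<in>?S d a. f d a u) * (\<Sum>v\<in>?S e b. f e b v)"
    by (simp add: sum_product)
  also have "\<dots> = a * b"
    using eq[OF assms(1)] eq[OF assms(2)] by simp
  finally show ?thesis .
qed

lemma homogeneous_1: "homogeneous 0 1"
  using homogeneous_single_monom[of 0 0 1] by (simp add: monom_0 flip: one_pCons)

lemma homogeneous_power: "homogeneous d a \<Longrightarrow> homogeneous (n * d) (a ^ n)"
  by (induction n) (auto intro: homogeneous_1 homogeneous_mult)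

lemma homogeneous_gen_elem: "homogeneous 1 (gen_elem g)"
  using homogeneous_single_monom[of 0 "Word [g]" 1] by (simp add: gen_elem_def monom_0 one_pCons)

lemma homogeneous_hbar: "homogeneous 1 hbar"
  using homogeneous_single_monom[of 1 0 1]
  by (simp add: hbar_def scal_def monom_Suc monom_0 zero_free_monoid_def)

lemma homogeneous_scal_monom: "homogeneous i (scal (monom c i))"
  using homogeneous_single_monom[of i 0 c] by (simp add: scal_def zero_free_monoid_def)

lemma homogeneous_rho: "homogeneous 1 rho"
  by (simp only: rho_def homogeneous_gen_elem)

lemma homogeneous_xi: "homogeneous 1 xi"
  by (simp only: xi_def rho_def gen_y_def homogeneous_gen_elem homogeneous_diff)

lemma homogeneous_zgen: "k \<ge> 1 \<Longrightarrow> homogeneous k (zgen k)"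
  using homogeneous_mult[OF homogeneous_power[OF homogeneous_gen_elem, of "k - 1"] homogeneous_gen_elem]
  by (simp add: zgen_def gen_x_def gen_y_def)

lemma homogeneous_phi:
  assumes "k \<ge> 1"
  shows "homogeneous k (phi k)"
proof -
  have p: "homogeneous n ((- hbar) ^ n)" for n
    using homogeneous_power[OF homogeneous_uminus[OF homogeneous_hbar], of n] by simp
  have "homogeneous k ((- hbar) ^ (k - a) * zgen a)" if "a \<in> {2..k}" for a
    using homogeneous_mult[OF p[of "k - a"] homogeneous_zgen[of a]] that by simp
  moreover have "homogeneous k ((- hbar) ^ (k - 1) * xi)"
    using homogeneous_mult[OF p[of "k - 1"] homogeneous_xi] assms by simp
  ultimately show ?thesis
    unfolding phi_def by (intro homogeneous_add homogeneous_sum)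
qed

lemma weight_part_mult_homogeneous:
  assumes "homogeneous e g"
  shows "weight_part d (g * a) = (if e \<le> d then g * weight_part (d - e) a else 0)"
proof -
  let ?S = "{i. weight_part i a \<noteq> 0}"
  have "weight_part d (g * a) = weight_part d (\<Sum>i\<in>?S. g * weight_part i a)"
    by (subst weight_decomposition[of a]) (simp add: sum_distrib_left)
  also have "\<dots> = (\<Sum>i\<in>?S. if d = e + i then g * weight_part i a else 0)"
    unfolding weight_part_sum
    by (intro sum.cong refl weight_part_homogeneous homogeneous_mult assms homogeneous_weight_part)
  also have "\<dots> = (\<Sum>i\<in>?S. if i = d - e then if e \<le> d then g * weight_part (d - e) a else 0 else 0)"
    by (intro sum.cong) auto
  also have "\<dots> = (if e \<le> d then g * weight_part (d - e) a else 0)"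
    using finite_weights by (simp add: sum.delta)
  finally show ?thesis .
qed

lemma weight_part_scal: "weight_part d (scal c) = scal (monom (coeff c d) d)"
  by (rule poly_mapping_eqI)
     (auto simp: lookup_weight_part scal_def lookup_single when_def zero_free_monoid_def)

lemma weight_part_H1: "a \<in> H1 \<Longrightarrow> weight_part d a \<in> H1"
proof (induction arbitrary: d rule: H1.induct)
  case (H1_mult a b)
  have "a * b = (\<Sum>i | weight_part i a \<noteq> 0. weight_part i a * b)"
    by (subst weight_decomposition[of a]) (simp add: sum_distrib_right)
  then have "weight_part d (a * b) = (\<Sum>i | weight_part i a \<noteq> 0.
      if i \<le> d then weight_part i a * weight_part (d - i) b else 0)"
    by (simp add: weight_part_sum weight_part_mult_homogeneous[OF homogeneous_weight_part])
  with H1_mult show ?case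
    by (auto intro!: H1_sum H1.H1_mult)
qed (auto simp: weight_part_scal weight_part_add weight_part_homogeneous[OF homogeneous_xi]
      weight_part_homogeneous[OF homogeneous_zgen] intro: H1.intros)

lemma H0hat_subset_H1: "H0hat \<subseteq> H1"
  by (auto simp: H0hat_def intro!: H1_add H1_sum H1_mult H1_scal H1_xi H1_z)

lemma H0hatI:
  "a \<in> H1 \<Longrightarrow> \<forall>k. b k \<in> H1 \<Longrightarrow> scal c + xi * a + (\<Sum>k = 2..N. zgen k * b k) \<in> H0hat"
  unfolding H0hat_def by (rule CollectI, rule exI[of _ c], rule exI[of _ a],
    rule exI[of _ N], rule exI[of _ b]) simp

lemma weight_part_H0hat:
  assumes "h \<in> H0hat"
  shows "weight_part d h \<in> H0hat"
proof -
  obtain c a N b where h: "h = scal c + xi * a + (\<Sum>k = 2..N. zgen k * b k)"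
    and a: "a \<in> H1" and b: "\<And>k. b k \<in> H1"
    using assms by (auto simp: H0hat_def)
  let ?a = "if 1 \<le> d then weight_part (d - 1) a else 0"
  let ?b = "\<lambda>k. if k \<le> d then weight_part (d - k) (b k) else 0"
  have "weight_part d (zgen k * b k) = zgen k * ?b k" if "k \<in> {2..N}" for k
    using that by (simp add: weight_part_mult_homogeneous[OF homogeneous_zgen])
  moreover have "weight_part d (xi * a) = xi * ?a"
    by (simp add: weight_part_mult_homogeneous[OF homogeneous_xi])
  ultimately have eq: "weight_part d h = scal (monom (coeff c d) d) + xi * ?a + (\<Sum>k = 2..N. zgen k * ?b k)"
    by (simp add: h weight_part_add weight_part_sum weight_part_scal)
  have "?a \<in> H1" "\<forall>k. ?b k \<in> H1"
    using a b by (simp_all add: weight_part_H1)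
  then show ?thesis
    unfolding eq by (rule H0hatI)
qed

lemma Zq_0 [simp]: "Zq q 0 = 0"
  using Zq_scale[of 1 q 0] by simp

lemma Zq_bar_superset:
  assumes "finite S" "{d. weight_part d h \<noteq> 0} \<subseteq> S"
  shows "Zq_bar q h = (\<Sum>d\<in>S. inverse ((1 - q) ^ d) * Zq q (weight_part d h))"
  unfolding Zq_bar_def using assms by (intro sum.mono_neutral_left) auto

lemma Zq_bar_homogeneous:
  assumes "homogeneous d h"
  shows "Zq_bar q h = inverse ((1 - q) ^ d) * Zq q h"
proof -
  have "{e. weight_part e h \<noteq> 0} \<subseteq> {d}"
    using weight_part_homogeneous[OF assms] by auto
  then show ?thesis
    by (simp add: Zq_bar_superset[of "{d}"] weight_part_homogeneous[OF assms])
qed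

lemma Zq_bar_add:
  assumes "a \<in> H0hat" "b \<in> H0hat"
  shows "Zq_bar q (a + b) = Zq_bar q a + Zq_bar q b"
proof -
  let ?S = "{d. weight_part d a \<noteq> 0} \<union> {d. weight_part d b \<noteq> 0}"
  have fin: "finite ?S" by (simp add: finite_weights)
  have sub: "{d. weight_part d (a + b) \<noteq> 0} \<subseteq> ?S" by (auto simp: weight_part_add)
  have "weight_part d a \<in> H1" "weight_part d b \<in> H1" for d
    using assms weight_part_H0hat H0hat_subset_H1 by blast+
  then have "Zq q (weight_part d (a + b)) = Zq q (weight_part d a) + Zq q (weight_part d b)" for d
    by (simp add: weight_part_add Zq_add)
  then show ?thesis
    by (simp add: Zq_bar_superset[OF fin sub] Zq_bar_superset[OF fin Un_upper1]
        Zq_bar_superset[OF fin Un_upper2] distrib_left sum.distrib)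
qed

lemma Zq_bar_scale:
  assumes "a \<in> H0hat"
  shows "Zq_bar q (scal [:t:] * a) = of_rat t * Zq_bar q a"
proof -
  have t: "homogeneous 0 (scal [:t:])"
    using homogeneous_scal_monom[of 0 t] by (simp add: monom_0)
  have w: "weight_part d (scal [:t:] * a) = scal [:t:] * weight_part d a" for d
    by (simp add: weight_part_mult_homogeneous[OF t])
  have H: "weight_part d a \<in> H1" for d
    using assms weight_part_H0hat H0hat_subset_H1 by blast
  have "act q [:t:] = of_rat t"
    by (cases "t = 0") (simp_all add: act_def map_poly_pCons)
  then have "Zq q (weight_part d (scal [:t:] * a)) = of_rat t * Zq q (weight_part d a)" for d
    by (simp add: w Zq_scale[OF H])
  moreover have "{d. weight_part d (scal [:t:] * a) \<noteq> 0} \<subseteq> {d. weight_part d a \<noteq> 0}"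
    by (auto simp: w)
  ultimately show ?thesis
    by (simp add: Zq_bar_superset[OF finite_weights[of a]] Zq_bar_superset[OF finite_weights[of a] order_refl]
        sum_distrib_left mult.left_commute)
qed

lemma H0hat_add:
  assumes "h \<in> H0hat" "h' \<in> H0hat"
  shows "h + h' \<in> H0hat"
proof -
  obtain c a N b where h: "h = scal c + xi * a + (\<Sum>k = 2..N. zgen k * b k)"
    and a: "a \<in> H1" and b: "\<And>k. b k \<in> H1"
    using assms(1) by (auto simp: H0hat_def)
  obtain c' a' N' b' where h': "h' = scal c' + xi * a' + (\<Sum>k = 2..N'. zgen k * b' k)"
    and a': "a' \<in> H1" and b': "\<And>k. b' k \<in> H1"
    using assms(2) by (auto simp: H0hat_def)
  let ?M = "max N N'"
  let ?b = "\<lambda>k. (if k \<le> N then b k else 0) + (if k \<le> N' then b' k else 0)"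
  have ext: "(\<Sum>k = 2..n. zgen k * f k) = (\<Sum>k = 2..?M. zgen k * (if k \<le> n then f k else 0))"
    if "n \<le> ?M" for n f
    using that by (intro sum.mono_neutral_cong_left) auto
  have "(\<Sum>k = 2..N. zgen k * b k) + (\<Sum>k = 2..N'. zgen k * b' k) = (\<Sum>k = 2..?M. zgen k * ?b k)" (is "?A + ?B = ?C")
    using ext[of N b] ext[of N' b'] by (simp add: distrib_left sum.distrib)
  then have eq: "h + h' = scal (c + c') + xi * (a + a') + (\<Sum>k = 2..?M. zgen k * ?b k)"
    unfolding h h' scal_add distrib_left[of xi] \<open>?A + ?B = ?C\<close>[symmetric] by (simp only: ac_simps)
  have "a + a' \<in> H1" "\<forall>k. ?b k \<in> H1"
    using a a' b b' by (simp_all add: H1_add)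
  then show ?thesis
    unfolding eq by (rule H0hatI)
qed

lemma xi_mult_H0hat: "a \<in> H1 \<Longrightarrow> xi * a \<in> H0hat"
  unfolding H0hat_def
  by (rule CollectI, rule exI[of _ 0], rule exI[of _ a], rule exI[of _ 0], rule exI[of _ "\<lambda>_. 0"]) simp

lemma zgen_mult_H0hat:
  assumes "k \<ge> 2" "a \<in> H1"
  shows "zgen k * a \<in> H0hat"
proof -
  have "(\<Sum>j = 2..k. zgen j * (if j = k then a else 0)) = (\<Sum>j = 2..k. if j = k then zgen k * a else 0)"
    by (intro sum.cong) auto
  also have "\<dots> = zgen k * a" using assms by simp
  finally show ?thesis
    unfolding H0hat_def using assms
    by (intro CollectI exI[of _ 0] exI[of _ k] exI[of _ "\<lambda>j. if j = k then a else 0"]) simp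
qed

lemma H0hat_sum: "(\<And>i. i \<in> S \<Longrightarrow> f i \<in> H0hat) \<Longrightarrow> (\<Sum>i\<in>S. f i) \<in> H0hat"
  using xi_mult_H0hat[of 0]
  by (induction S rule: infinite_finite_induct) (auto intro: H0hat_add)

lemma hbar_commute: "(- hbar) ^ n * a = a * (- hbar) ^ n"
proof (rule power_commuting_commutes)
  have "hbar * a = a * hbar"
    unfolding hbar_def by (rule scal_commute[symmetric])
  then show "- hbar * a = a * - hbar" by simp
qed

lemma rho_H1: "rho \<in> H1"
proof -
  have "rho = zgen 1 + - xi" by (simp add: xi_def zgen_def)
  then show ?thesis using H1_add[OF H1_z[of 1] H1_minus[OF H1_xi]] by simp
qed

lemma phi_mult_H0hat:
  assumes "a \<in> H1"
  shows "phi k * a \<in> H0hat"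
proof -
  have p: "(- hbar) ^ n * a \<in> H1" for n
    using assms unfolding hbar_def by (intro H1_mult H1_power H1_minus H1_scal)
  have c: "(- hbar) ^ n * b * a = b * ((- hbar) ^ n * a)" for n b
    by (simp only: hbar_commute[of n b] mult.assoc)
  have "phi k * a = (\<Sum>j = 2..k. zgen j * ((- hbar) ^ (k - j) * a)) + xi * ((- hbar) ^ (k - 1) * a)"
    unfolding phi_def distrib_right sum_distrib_right c ..
  moreover have "(\<Sum>j = 2..k. zgen j * ((- hbar) ^ (k - j) * a)) \<in> H0hat"
    by (rule H0hat_sum) (simp add: zgen_mult_H0hat p)
  ultimately show ?thesis
    using H0hat_add xi_mult_H0hat[OF p[of "k - 1"]] by simp
qed

lemma phi_rho_product_H0hat:
  assumes "js \<noteq> []"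
  shows "prod_list (map (\<lambda>i. phi (\<alpha> i + 1) * rho ^ \<beta> i) js) \<in> H0hat"
proof -
  have H1: "prod_list (map (\<lambda>i. phi (\<alpha> i + 1) * rho ^ \<beta> i) js) \<in> H1" for js
  proof (induction js)
    case (Cons j js)
    then have "phi (\<alpha> j + 1) * (rho ^ \<beta> j * prod_list (map (\<lambda>i. phi (\<alpha> i + 1) * rho ^ \<beta> i) js)) \<in> H0hat"
      by (intro phi_mult_H0hat H1_mult H1_power rho_H1)
    then show ?case using H0hat_subset_H1 by (auto simp: mult.assoc)
  qed simp
  obtain j js' where "js = j # js'" using assms by (cases js) auto
  then show ?thesis
    using phi_mult_H0hat[OF H1_mult[OF H1_power[OF rho_H1] H1[of js']]] by (simp add: mult.assoc)
qed

end

theory Submission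
  imports Defs
begin

text \<open>
  Since \<open>I\<^sub>\<rho>(n) = 1 - q\<close> is constant and \<open>I\<close> of \<open>\<phi>\<^sub>k\<close> telescopes to
  \<open>(1 - q)\<^sup>k (q\<^sup>n / (1 - q\<^sup>n))\<^sup>k\<close>, the normalised value of the product is the sum over
  \<open>n\<^sub>1 > \<dots> > n\<^sub>r > n\<^sub>r\<^sub>+\<^sub>1 = 0\<close> of
  \<open>\<Prod>\<^sub>i (q\<^bsup>n\<^sub>i\<^esup> / (1 - q\<^bsup>n\<^sub>i\<^esup>))\<^bsup>\<alpha>\<^sub>i+1\<^esup> (n\<^sub>i - n\<^sub>i\<^sub>+\<^sub>1 - 1 choose \<beta>\<^sub>i)\<close>.
  Expanding the powers by \<open>\<Sum>\<^sub>m (m - 1 choose \<alpha>\<^sub>i) q\<^bsup>mn\<^esup>\<close> and writing \<open>l\<^sub>i = n\<^sub>i - n\<^sub>i\<^sub>+\<^sub>1\<close>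
  yields a sum over positive \<open>m\<^sub>i, l\<^sub>i\<close> of
  \<open>\<Prod>\<^sub>i (m\<^sub>i - 1 choose \<alpha>\<^sub>i) (l\<^sub>i - 1 choose \<beta>\<^sub>i)\<close> times \<open>q\<close> to the power
  \<open>\<Sum>\<^sub>i\<^sub>\<le>\<^sub>j m\<^sub>i l\<^sub>j\<close>, which is invariant under exchanging \<open>m\<close> and \<open>l\<close> and reversing the order.
\<close>

section \<open>Linear functionals on \<open>H1\<close> fixed by their values on words, and the top
  coefficients of \<open>Zq\<close>\<close>

definition linext :: "complex \<Rightarrow> (letter list \<Rightarrow> complex) \<Rightarrow> alg \<Rightarrow> complex"
  where "linext q F h =
    (\<Sum>w\<in>Poly_Mapping.keys (coords h). act q (Poly_Mapping.lookup (coords h) w) * F w)"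

lemma linext_lincomb_superset:
  assumes "finite S" "Poly_Mapping.keys c \<subseteq> S"
  shows "linext q F (lincomb c) = (\<Sum>w\<in>S. act q (Poly_Mapping.lookup c w) * F w)"
  unfolding linext_def coords_lincomb using assms
  by (intro sum.mono_neutral_left) (auto simp: in_keys_iff)

lemma linext_add:
  assumes "a \<in> H1" "b \<in> H1"
  shows "linext q F (a + b) = linext q F a + linext q F b"
proof -
  obtain c d where cd: "a = lincomb c" "b = lincomb d"
    using assms by (auto simp: H1_eq_range_lincomb)
  let ?S = "Poly_Mapping.keys c \<union> Poly_Mapping.keys d"
  have "Poly_Mapping.keys (c + d) \<subseteq> ?S" by (rule Poly_Mapping.keys_add)
  then have "linext q F (lincomb (c + d)) = linext q F (lincomb c) + linext q F (lincomb d)"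
    by (simp add: linext_lincomb_superset[of ?S] lookup_add act_add distrib_right sum.distrib)
  then show ?thesis by (simp add: cd lincomb_add)
qed

lemma linext_scale:
  assumes "a \<in> H1"
  shows "linext q F (scal p * a) = act q p * linext q F a"
proof -
  obtain c where c: "a = lincomb c"
    using assms by (auto simp: H1_eq_range_lincomb)
  define d where "d = Poly_Mapping.map ((*) p) c"
  have l: "Poly_Mapping.lookup d w = p * Poly_Mapping.lookup c w" for w
    by (simp add: d_def Poly_Mapping.map.rep_eq when_def)
  have sub: "Poly_Mapping.keys d \<subseteq> Poly_Mapping.keys c"
    by (auto simp: in_keys_iff l)
  have "scal p * a = lincomb d"
    unfolding c lincomb_superset[OF finite_keys sub] lincomb_superset[OF finite_keys order_refl, of c]
      sum_distrib_left by (simp add: l scal_mult mult.assoc)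
  then show ?thesis
    unfolding c by (simp only: linext_lincomb_superset[OF finite_keys sub]
        linext_lincomb_superset[OF finite_keys order_refl, of _ _ c])
      (simp add: l act_mult sum_distrib_left mult.assoc)
qed

lemma linext_0 [simp]: "linext q F 0 = 0"
  using linext_scale[of 1 q F 0] by simp

lemma linext_sum:
  assumes "\<And>i. i \<in> S \<Longrightarrow> f i \<in> H1"
  shows "linext q F (\<Sum>i\<in>S. f i) = (\<Sum>i\<in>S. linext q F (f i))"
  using assms
  by (induction S rule: infinite_finite_induct) (auto simp: linext_add H1_sum)

lemma linext_word_elem: "linext q F (word_elem w) = F w"
proof -
  have "word_elem w = lincomb (Poly_Mapping.single w 1)" by (simp add: lincomb_single)
  then show ?thesis by (simp add: linext_def)
qed

text \<open>Induction along the basis of words instead of the generation of \<open>H1\<close> as an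
  algebra: it suits properties that are linear but say nothing about products.\<close>

lemma H1_induct [consumes 1, case_names word scale add]:
  assumes "h \<in> H1"
    and word: "\<And>w. P (word_elem w)"
    and scale: "\<And>c a. a \<in> H1 \<Longrightarrow> P a \<Longrightarrow> P (scal c * a)"
    and add: "\<And>a b. a \<in> H1 \<Longrightarrow> b \<in> H1 \<Longrightarrow> P a \<Longrightarrow> P b \<Longrightarrow> P (a + b)"
  shows "P h"
proof -
  obtain c where h: "h = lincomb c"
    using assms by (auto simp: H1_eq_range_lincomb)
  have P0: "P 0" using scale[OF word_elem_H1 word, of 0 "[]"] by simp
  let ?t = "\<lambda>w. scal (Poly_Mapping.lookup c w) * word_elem w"
  have "P (\<Sum>w\<in>S. ?t w)" for S
    by (induction S rule: infinite_finite_induct)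
       (auto intro!: P0 add scale word H1_mult H1_sum H1_scal word_elem_H1)
  then show ?thesis by (simp add: h lincomb_def)
qed

lemma letter_elem_H1: "letter_elem l \<in> H1"
  by (cases l) (auto intro: H1_xi H1_z)

text \<open>Left multiplication by a letter sends the basis word \<open>w\<close> to
  \<open>l # w\<close>, and scalars are central, so linearity carries this over to all of
  \<open>H1\<close>.\<close>

lemma linext_letter_mult:
  assumes "a \<in> H1"
  shows "linext q F (letter_elem l * a) = linext q (\<lambda>w. F (l # w)) a"
  using assms
proof (induction rule: H1_induct)
  case (word w)
  have "letter_elem l * word_elem w = word_elem (l # w)" by (simp add: word_elem_def)
  then show ?case by (simp only: linext_word_elem)
next
  case (scale c a)
  have "letter_elem l * (scal c * a) = scal c * (letter_elem l * a)"
    by (simp only: mult.assoc[symmetric] scal_commute[of "letter_elem l" c])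
  with scale show ?case by (simp add: linext_scale H1_mult letter_elem_H1)
next
  case (add a b)
  then show ?case by (simp add: distrib_left linext_add H1_mult letter_elem_H1)
qed

lemma linext_cmult: "linext q (\<lambda>w. c * F w) h = c * linext q F h"
  by (simp add: linext_def sum_distrib_left mult.left_commute)

lemma linext_fun_sum: "linext q (\<lambda>w. \<Sum>i\<in>S. F i w) h = (\<Sum>i\<in>S. linext q (F i) h)"
  by (simp add: linext_def sum_distrib_left) (rule sum.swap)

text \<open>The recursion strips off the largest index of a decreasing tuple. The empty tuple counts
  as having largest index 0, so \<open>k = 0\<close> in the inner sum contributes exactly when no
  letter is left.\<close>

fun level_sum :: "('l \<Rightarrow> nat \<Rightarrow> 'a :: comm_semiring_1) \<Rightarrow> nat \<Rightarrow> 'l list \<Rightarrow> 'a" where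
  "level_sum g n [] = (if n = 0 then 1 else 0)"
| "level_sum g n (l # w) = (if n = 0 then 0 else g l n * (\<Sum>k<n. level_sum g k w))"

text \<open>The part of the series for \<open>Z\<^sub>q\<close> with largest summation index \<open>n\<close>; \<open>n = 0\<close> stands for the
  empty tuple.\<close>

definition top_coeff :: "complex \<Rightarrow> nat \<Rightarrow> alg \<Rightarrow> complex"
  where "top_coeff q n = linext q (level_sum (I_letter q) n)"

lemma top_coeff_letter_mult:
  assumes "a \<in> H1"
  shows "top_coeff q n (letter_elem l * a) =
    (if n = 0 then 0 else I_letter q l n * (\<Sum>k<n. top_coeff q k a))"
  by (simp add: top_coeff_def linext_letter_mult[OF assms] linext_cmult linext_fun_sum)
    (simp add: linext_def)

lemma top_coeff_1: "top_coeff q n 1 = (if n = 0 then 1 else 0)"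
  using linext_word_elem[of q "level_sum (I_letter q) n" "[]"] by (simp add: top_coeff_def)

lemma one_minus_power_nonzero:
  fixes q :: "'a :: real_normed_div_algebra"
  assumes "norm q < 1" "n > 0"
  shows "1 - q ^ n \<noteq> 0"
proof
  assume "1 - q ^ n = 0"
  then have "norm q ^ n = 1" by (metis eq_iff_diff_eq_0 norm_one norm_power)
  with power_strict_mono[of "norm q" 1 n] assms show False by simp
qed

text \<open>Since \<rho> = z_1 - \<xi>, its value at n is 1/[n] - q^n/[n] = 1 - q, independent of n:
  a factor \<rho> only inserts a further summation index.\<close>

lemma top_coeff_rho_mult:
  assumes "norm q < 1" "a \<in> H1"
  shows "top_coeff q n (rho * a) = (if n = 0 then 0 else (1 - q) * (\<Sum>k<n. top_coeff q k a))"
proof -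
  have "rho * a = letter_elem (LZ 0) * a + scal (- 1) * (letter_elem LXi * a)"
    by (simp add: xi_def zgen_def scal_def single_uminus algebra_simps)
  moreover have "act q (- 1) = - 1"
    using act_add[of q 1 "- 1"] by (simp add: eq_neg_iff_add_eq_0 add.commute)
  ultimately have eq: "top_coeff q n (rho * a) = top_coeff q n (letter_elem (LZ 0) * a) - top_coeff q n (letter_elem LXi * a)"
    using assms letter_elem_H1 unfolding top_coeff_def
    by (simp only: linext_add linext_scale H1_mult H1_scal) simp
  show ?thesis
  proof (cases "n = 0")
    case False
    let ?X = "\<Sum>k<n. top_coeff q k a"
    have "1 - q ^ n \<noteq> 0"
      using False assms one_minus_power_nonzero by blast
    moreover have "?X / qint q n - q ^ n * ?X / qint q n = (1 - q ^ n) * ?X / qint q n"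
      by (simp add: diff_divide_distrib left_diff_distrib)
    ultimately have "?X / qint q n - q ^ n * ?X / qint q n = (1 - q) * ?X"
      by (simp add: qint_def)
    then show ?thesis
      using False by (simp only: eq top_coeff_letter_mult[OF assms(2)]) simp
  next
    case True
    then show ?thesis
      unfolding eq top_coeff_letter_mult[OF assms(2)] by simp
  qed
qed

subsection \<open>Evaluation of \<open>\<phi>\<^sub>k\<close>\<close>

lemma uminus_hbar_power: "(- hbar) ^ n = scal ([:0, - 1:] ^ n)"
proof (induction n)
  case (Suc n)
  have "- hbar = scal [:0, - 1:]"
    by (simp add: hbar_def scal_def flip: single_uminus)
  with Suc show ?case by (simp only: power_Suc scal_mult)
qed simp

lemma act_power: "act q (p ^ n) = act q p ^ n"
  by (induction n) (simp_all add: act_mult)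

text \<open>\<open>LZ (j - 1)\<close> is z_j, and -\<hbar> acts as q - 1. Passing from k to k + 1
  multiplies the left side by q - 1 and adds the value of z_{k+1}.\<close>

lemma I_phi:
  assumes "norm q < 1" "n > 0" "k \<ge> 1"
  shows "(\<Sum>j = 2..k. (q - 1) ^ (k - j) * I_letter q (LZ (j - 1)) n) + (q - 1) ^ (k - 1) * I_letter q LXi n
    = (1 - q) ^ k * (q ^ n / (1 - q ^ n)) ^ k"
  using \<open>k \<ge> 1\<close>
proof (induction k rule: dec_induct)
  case base
  then show ?case by (simp add: qint_def)
next
  case (step k)
  let ?u = "q ^ n / (1 - q ^ n)"
  have nz: "1 - q ^ n \<noteq> 0" using assms one_minus_power_nonzero by blast
  have "(\<Sum>j = 2..Suc k. (q - 1) ^ (Suc k - j) * I_letter q (LZ (j - 1)) n)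
      = (\<Sum>j = 2..k. (q - 1) ^ (Suc k - j) * I_letter q (LZ (j - 1)) n) + I_letter q (LZ k) n"
    using step.hyps by (simp add: sum.cl_ivl_Suc)
  also have "(\<Sum>j = 2..k. (q - 1) ^ (Suc k - j) * I_letter q (LZ (j - 1)) n)
      = (q - 1) * (\<Sum>j = 2..k. (q - 1) ^ (k - j) * I_letter q (LZ (j - 1)) n)"
    unfolding sum_distrib_left by (intro sum.cong) (auto simp: Suc_diff_le simp del: I_letter.simps)
  moreover have "(q - 1) ^ (Suc k - 1) = (q - 1) * (q - 1) ^ (k - 1)"
    using step.hyps by (simp flip: power_Suc)
  ultimately have "(\<Sum>j = 2..Suc k. (q - 1) ^ (Suc k - j) * I_letter q (LZ (j - 1)) n)
        + (q - 1) ^ (Suc k - 1) * I_letter q LXi n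
      = (q - 1) * ((1 - q) ^ k * ?u ^ k) + I_letter q (LZ k) n"
    unfolding step.IH[symmetric] by (simp only: distrib_left mult.assoc add.assoc add.commute add.left_commute)
  also have "I_letter q (LZ k) n = (1 - q) ^ Suc k * (?u ^ k * (1 / (1 - q ^ n)))"
    by (simp add: qint_def power_divide power_mult[symmetric] mult.commute)
  \<comment> \<open>The summand 1 produces a term that cancels the one with factor q - 1; only the
    summand \<open>?u\<close> survives.\<close>
  also have "1 / (1 - q ^ n) = 1 + ?u"
    using nz by (simp add: field_simps)
  also have "(q - 1) * ((1 - q) ^ k * ?u ^ k) + (1 - q) ^ Suc k * (?u ^ k * (1 + ?u))
      = (1 - q) ^ Suc k * ?u ^ Suc k"
    by (simp add: algebra_simps)
  finally show ?case .
qed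

lemma top_coeff_phi_mult:
  assumes "norm q < 1" "a \<in> H1" "k \<ge> 1"
  shows "top_coeff q n (phi k * a) = (if n = 0 then 0 else
    (1 - q) ^ k * (q ^ n / (1 - q ^ n)) ^ k * (\<Sum>j<n. top_coeff q j a))"
proof -
  let ?s = "\<lambda>m. scal ([:0, - 1:] ^ m)"
  \<comment> \<open>With the case n = 0 absorbed here, every letter contributes its value times the
    same factor.\<close>
  let ?T = "if n = 0 then 0 else (\<Sum>j<n. top_coeff q j a)"
  have act: "act q ([:0, - 1:] ^ m) = (q - 1) ^ m" for m
  proof -
    have "act q [:0, - 1:] = q - 1" by (simp add: act_def map_poly_pCons)
    then show ?thesis by (simp only: act_power)
  qed
  have H: "letter_elem l * a \<in> H1" for l
    using assms by (intro H1_mult letter_elem_H1)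
  have "phi k * a = (\<Sum>j = 2..k. ?s (k - j) * (letter_elem (LZ (j - 1)) * a))
      + ?s (k - 1) * (letter_elem LXi * a)"
    unfolding phi_def uminus_hbar_power distrib_right sum_distrib_right
    by (simp add: mult.assoc)
  then have "top_coeff q n (phi k * a) = (\<Sum>j = 2..k. (q - 1) ^ (k - j) * top_coeff q n (letter_elem (LZ (j - 1)) * a))
      + (q - 1) ^ (k - 1) * top_coeff q n (letter_elem LXi * a)"
    by (simp only: top_coeff_def linext_add linext_sum linext_scale H H1_mult H1_scal H1_sum act)
  also have "\<dots> = ((\<Sum>j = 2..k. (q - 1) ^ (k - j) * I_letter q (LZ (j - 1)) n)
      + (q - 1) ^ (k - 1) * I_letter q LXi n) * ?T"
    by (simp add: top_coeff_letter_mult[OF \<open>a \<in> H1\<close>] distrib_right sum_distrib_right mult.assoc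
        del: letter_elem.simps I_letter.simps)
  finally show ?thesis
    using I_phi[of q n k] assms by (auto simp del: I_letter.simps)
qed

subsection \<open>Convergence\<close>

text \<open>Induction on a. Multiplying by the geometric series replaces the coefficients by their
  partial sums, which are again binomial by the hockey-stick identity; a factor t then shifts the
  index. The Cauchy product requires absolute convergence, so both claims are proved
  together.\<close>

lemma choose_power_series:
  fixes t :: "'a :: {real_normed_field, banach}"
  assumes "norm t < 1"
  shows choose_power_sums: "(\<lambda>m. of_nat (m choose a) * t ^ m) sums (t ^ a / (1 - t) ^ Suc a)"
    and choose_power_norm_summable: "summable (\<lambda>m. norm (of_nat (m choose a) * t ^ m))"
proof -
  \<comment> \<open>Stated over any commutative semiring to serve both for \<open>t\<close> and for
    the real number \<open>norm t\<close>.\<close>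
  have conv: "(\<Sum>i\<le>k. of_nat (i choose a) * s ^ i * s ^ (k - i)) = of_nat (Suc k choose Suc a) * s ^ k"
    for k a and s :: "'b :: comm_semiring_1"
  proof -
    have "(\<Sum>i\<le>k. of_nat (i choose a) * s ^ i * s ^ (k - i)) = (\<Sum>i\<le>k. of_nat (i choose a) * s ^ k)"
      by (intro sum.cong) (auto simp: mult.assoc simp flip: power_add)
    also have "\<dots> = of_nat (\<Sum>i\<le>k. i choose a) * s ^ k"
      by (simp add: sum_distrib_right)
    finally show ?thesis by (simp only: sum_choose_upper)
  qed
  have geo: "summable (\<lambda>m. norm (t ^ m))"
    using assms by (simp add: norm_power)
  have "(\<lambda>m. of_nat (m choose a) * t ^ m) sums (t ^ a / (1 - t) ^ Suc a)
      \<and> summable (\<lambda>m. norm (of_nat (m choose a) * t ^ m))"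
  proof (induction a)
    case 0
    then show ?case using geometric_sums[OF assms] geo by simp
  next
    case (Suc a)
    have nz: "1 - t \<noteq> 0" using assms by auto
    have "(\<lambda>k. of_nat (Suc k choose Suc a) * t ^ k) sums (t ^ a / (1 - t) ^ Suc a * (1 / (1 - t)))"
      using Cauchy_product_sums[OF Suc[THEN conjunct2] geo] Suc[THEN conjunct1] geometric_sums[OF assms]
      by (simp only: conv) (simp add: sums_iff)
    from sums_mult[OF this, of t]
    have "(\<lambda>k. of_nat (Suc k choose Suc a) * t ^ Suc k) sums (t ^ Suc a / (1 - t) ^ Suc (Suc a))"
      by (simp add: ac_simps)
    then have 1: "(\<lambda>m. of_nat (m choose Suc a) * t ^ m) sums (t ^ Suc a / (1 - t) ^ Suc (Suc a))"
      by (subst (asm) sums_Suc_iff) simp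
    have "summable (\<lambda>k. \<Sum>i\<le>k. of_nat (i choose a) * norm t ^ i * norm t ^ (k - i))"
      using Suc geo by (intro summable_Cauchy_product) (simp_all add: norm_mult norm_power)
    then have "summable (\<lambda>k. norm t * (of_nat (Suc k choose Suc a) * norm t ^ k))"
      by (intro summable_mult) (simp only: conv)
    then have "summable (\<lambda>k. of_nat (Suc k choose Suc a) * norm t ^ Suc k)"
      by (simp add: ac_simps)
    then have "summable (\<lambda>m. norm (of_nat (m choose Suc a) * t ^ m))"
      by (subst (asm) summable_Suc_iff) (simp add: norm_mult norm_power)
    with 1 show ?case by simp
  qed
  then show "(\<lambda>m. of_nat (m choose a) * t ^ m) sums (t ^ a / (1 - t) ^ Suc a)"
    and "summable (\<lambda>m. norm (of_nat (m choose a) * t ^ m))" by auto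
qed

section \<open>Regrouping the series of a word by the largest index\<close>

definition level :: "nat \<Rightarrow> nat \<Rightarrow> nat list set"
  where "level r n = {ns \<in> decr_tuples r. (case ns of [] \<Rightarrow> 0 | m # _ \<Rightarrow> m) = n}"

lemma level_0: "level 0 n = (if n = 0 then {[]} else {})"
  by (auto simp: level_def decr_tuples_def)

lemma level_Suc: "level (Suc r) n = (if n = 0 then {} else Cons n ` (\<Union>k<n. level r k))"
proof (intro equalityI subsetI)
  fix ns assume "ns \<in> level (Suc r) n"
  then obtain ms where ms: "ns = n # ms" "length ms = r" "sorted_wrt (>) ms" "\<forall>m\<in>set ms. 0 < m \<and> m < n" "n > 0"
    by (auto simp: level_def decr_tuples_def split: list.splits)
  then have "ms \<in> level r (case ms of [] \<Rightarrow> 0 | m # _ \<Rightarrow> m)"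
    by (auto simp: level_def decr_tuples_def)
  moreover have "(case ms of [] \<Rightarrow> 0 | m # _ \<Rightarrow> m) < n"
    using ms by (auto split: list.splits)
  ultimately show "ns \<in> (if n = 0 then {} else Cons n ` (\<Union>k<n. level r k))"
    using ms by auto
next
  fix ns assume "ns \<in> (if n = 0 then {} else Cons n ` (\<Union>k<n. level r k))"
  then obtain ms k where "n > 0" "k < n" "ns = n # ms" "ms \<in> level r k"
    by (auto split: if_splits)
  then show "ns \<in> level (Suc r) n"
    by (cases ms) (auto simp: level_def decr_tuples_def)
qed

lemma finite_level: "finite (level r n)"
  by (induction r arbitrary: n) (simp_all add: level_0 level_Suc)

lemma level_disjoint: "k \<noteq> k' \<Longrightarrow> level r k \<inter> level r k' = {}"
  by (auto simp: level_def)

text \<open>Below the first entry n, the remaining tuples split disjointly according to their own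
  largest entry k < n, which is the recursion of \<open>level_sum\<close>.\<close>

lemma sum_level: "(\<Sum>ns\<in>level (length w) n. \<Prod>i<length w. g (w ! i) (ns ! i)) = level_sum g n w"
proof (induction w arbitrary: n)
  case Nil
  then show ?case by (simp add: level_0)
next
  case (Cons l w)
  show ?case
  proof (cases "n = 0")
    case True
    then show ?thesis by (simp add: level_Suc)
  next
    case False
    have "(\<Sum>ns\<in>level (length (l # w)) n. \<Prod>i<length (l # w). g ((l # w) ! i) (ns ! i))
        = (\<Sum>ms\<in>(\<Union>k<n. level (length w) k). g l n * (\<Prod>i<length w. g (w ! i) (ms ! i)))"
      using False by (simp add: level_Suc sum.reindex prod.lessThan_Suc_shift del: prod.lessThan_Suc)
    also have "\<dots> = (\<Sum>k<n. \<Sum>ms\<in>level (length w) k. g l n * (\<Prod>i<length w. g (w ! i) (ms ! i)))"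
      by (rule sum.UNION_disjoint) (auto simp: finite_level dest: level_disjoint)
    also have "\<dots> = level_sum g n (l # w)"
      using False by (simp add: Cons.IH flip: sum_distrib_left)
    finally show ?thesis .
  qed
qed

lemma sum_choose_lessThan: "(\<Sum>k<n. k choose r) = n choose Suc r"
  by (induction n) simp_all

text \<open>There are at most \<open>n choose r\<close> decreasing \<open>r\<close>-tuples of positive integers below \<open>n\<close>, so bounded factors give at most
  polynomial growth and one geometric factor in the largest index forces convergence.\<close>

lemma sum_level_sum_le:
  fixes g :: "'l \<Rightarrow> nat \<Rightarrow> real"
  assumes "\<And>l n. n > 0 \<Longrightarrow> 0 \<le> g l n \<and> g l n \<le> C l"
  shows "0 \<le> level_sum g n w \<and> (\<Sum>k<n. level_sum g k w) \<le> prod_list (map C w) * (n choose length w)"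
proof (induction w arbitrary: n)
  case Nil
  have "(\<Sum>k<n. level_sum g k []) \<le> 1" by (induction n) auto
  then show ?case by simp
next
  case (Cons l w)
  have pos: "0 \<le> level_sum g k w" for k using Cons by blast
  have C: "0 \<le> C l" using assms[of 1 l] by simp
  have "level_sum g k (l # w) \<le> C l * (prod_list (map C w) * (k choose length w))" for k
  proof (cases "k = 0")
    case True
    have "0 \<le> prod_list (map C w)"
      using assms[of 1] by (intro prod_list_nonneg) (auto intro: order_trans)
    with True C show ?thesis by simp
  next
    case False
    with Cons[of k] C assms[of k l] show ?thesis
      by (auto intro!: mult_mono sum_nonneg pos)
  qed
  then have "(\<Sum>k<n. level_sum g k (l # w)) \<le> (\<Sum>k<n. C l * (prod_list (map C w) * (k choose length w)))"
    by (rule sum_mono)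
  also have "\<dots> = prod_list (map C (l # w)) * (n choose length (l # w))"
    by (simp add: sum_choose_lessThan[symmetric] sum_distrib_left mult.assoc)
  finally show ?case
    using pos assms by (auto intro!: mult_nonneg_nonneg sum_nonneg)
qed

text \<open>For n > 0 we have |1 - q^n| \<ge> 1 - |q|, so c bounds |1/[n]| uniformly in n.\<close>

lemma I_letter_bound:
  assumes "norm q < 1" "n > 0"
  defines "c \<equiv> norm (1 - q) / (1 - norm q)"
  shows "norm (I_letter q LXi n) \<le> c * norm q ^ n"
    and "norm (I_letter q (LZ k) n) \<le> c ^ Suc k * norm q ^ (k * n)"
proof -
  have "norm q ^ n \<le> norm q"
    using assms power_decreasing[of 1 n "norm q"] by simp
  then have le: "1 - norm q \<le> norm (1 - q ^ n)"
    using norm_triangle_ineq2[of 1 "q ^ n"] by (simp add: norm_power)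
  have "norm (1 / qint q n) = norm (1 - q) / norm (1 - q ^ n)"
    by (simp add: qint_def norm_divide)
  also have "\<dots> \<le> c"
    unfolding c_def using le assms by (intro divide_left_mono mult_pos_pos) auto
  finally have c: "norm (1 / qint q n) \<le> c" .
  have "norm (I_letter q LXi n) = norm (1 / qint q n) * norm q ^ n"
    by (simp add: norm_divide norm_power)
  also have "\<dots> \<le> c * norm q ^ n" using c by (intro mult_right_mono) auto
  finally show "norm (I_letter q LXi n) \<le> c * norm q ^ n" .
  have "norm (I_letter q (LZ k) n) = norm (1 / qint q n) ^ Suc k * norm q ^ (k * n)"
    by (simp add: norm_divide norm_mult norm_power power_divide)
  also have "\<dots> \<le> c ^ Suc k * norm q ^ (k * n)" using c by (intro mult_right_mono power_mono) auto
  finally show "norm (I_letter q (LZ k) n) \<le> c ^ Suc k * norm q ^ (k * n)" .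
qed

text \<open>The first letter sits at the largest index n. As it is not z_1, it supplies a factor
  |q|^n that outweighs the polynomial growth from the other letters. Absolute convergence then
  permits summing by largest index.\<close>

lemma Zq_word_has_sum:
  assumes "norm q < 1" "w = [] \<or> hd w \<noteq> LZ 0"
  shows "((\<lambda>n. level_sum (I_letter q) n w) has_sum Zq_word q w) UNIV"
proof -
  define c where "c = norm (1 - q) / (1 - norm q)"
  have c0: "c \<ge> 0" using assms by (simp add: c_def)
  define C where "C l = (case l of LXi \<Rightarrow> c | LZ k \<Rightarrow> c ^ Suc k)" for l
  define g where "g l n = norm (I_letter q l n)" for l n
  have C0: "C l \<ge> 0" for l using c0 by (auto simp: C_def split: letter.split)
  have q1: "norm q ^ m \<le> 1" for m using assms by (intro power_le_one) auto
  have g: "0 \<le> g l n \<and> g l n \<le> C l" if "n > 0" for l n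
  proof -
    have "g l n \<le> C l * norm q ^ (case l of LXi \<Rightarrow> n | LZ k \<Rightarrow> k * n)"
      using I_letter_bound[OF assms(1) that]
      by (auto simp: g_def C_def c_def split: letter.split simp del: I_letter.simps)
    also have "\<dots> \<le> C l * 1" by (intro mult_left_mono q1 C0)
    finally show ?thesis by (simp add: g_def)
  qed
  \<comment> \<open>Excluding z_1 leaves \<xi> or \<open>LZ k\<close> with k \<ge> 1, hence an
    exponent of at least n.\<close>
  have g': "g l n \<le> C l * norm q ^ n" if "n > 0" "l \<noteq> LZ 0" for l n
  proof -
    have "g l n \<le> C l * norm q ^ (case l of LXi \<Rightarrow> n | LZ k \<Rightarrow> k * n)"
      using I_letter_bound[OF assms(1) that(1)]
      by (auto simp: g_def C_def c_def split: letter.split simp del: I_letter.simps)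
    also have "\<dots> \<le> C l * norm q ^ n"
      using that(2) assms(1) by (intro mult_left_mono power_decreasing C0) (auto split: letter.split)
    finally show ?thesis .
  qed
  have bound: "0 \<le> level_sum g n v \<and> (\<Sum>k<n. level_sum g k v) \<le> prod_list (map C v) * (n choose length v)" for n v
    by (rule sum_level_sum_le) (rule g)
  have nonneg: "0 \<le> level_sum g n v" for n v
    using bound by blast
  have summable: "summable (\<lambda>n. norm (level_sum g n w))"
  proof (cases w)
    case Nil
    then have "level_sum g n w = 0" if "n \<notin> {0}" for n using that by simp
    then show ?thesis by (intro summable_finite[of "{0}"]) auto
  next
    case (Cons l v)
    \<comment> \<open>The majorant combines the decay of the first letter with the binomial bound
      for the inner sum; it is a multiple of a series from
      \<open>choose_power_norm_summable\<close>.\<close>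
    have le: "norm (level_sum g n w) \<le> C l * prod_list (map C v) * norm ((n choose length v) * norm q ^ n)" for n
    proof (cases "n = 0")
      case False
      have "norm (level_sum g n w) = g l n * (\<Sum>k<n. level_sum g k v)"
        using False nonneg[of n w] Cons by simp
      also have "\<dots> \<le> (C l * norm q ^ n) * (prod_list (map C v) * (n choose length v))"
      proof (rule mult_mono)
        show "g l n \<le> C l * norm q ^ n"
          using False assms(2) Cons by (intro g') auto
        show "(\<Sum>k<n. level_sum g k v) \<le> prod_list (map C v) * (n choose length v)"
          using bound by blast
        show "0 \<le> C l * norm q ^ n" using C0 by simp
        show "0 \<le> (\<Sum>k<n. level_sum g k v)" by (intro sum_nonneg nonneg)
      qed
      finally show ?thesis by (simp add: mult_ac)
    next
      case True
      have "0 \<le> prod_list (map C v)" using C0 by (intro prod_list_nonneg) auto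
      with True Cons C0 show ?thesis by simp
    qed
    have sm: "summable (\<lambda>n. C l * prod_list (map C v) * norm ((n choose length v) * norm q ^ n))"
      by (rule summable_mult, rule choose_power_norm_summable) (use assms(1) in simp)
    show ?thesis
      by (rule summable_norm_comparison_test[OF _ sm]) (use le in blast)
  qed
  let ?f = "\<lambda>ns. \<Prod>i<length w. I_letter q (w ! i) (ns ! i)"
  \<comment> \<open>Each tuple paired with its largest entry; projecting to the second component is
    a bijection onto all decreasing tuples.\<close>
  let ?S = "SIGMA n:UNIV. level (length w) n"
  have "(\<lambda>p. norm (?f (snd p))) summable_on ?S"
  proof (rule summable_on_SigmaI)
    show "((\<lambda>ns. norm (?f (snd (n, ns)))) has_sum level_sum g n w) (level (length w) n)" for n
      by (rule has_sum_finiteI)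
         (simp_all add: finite_level g_def prod_norm flip: sum_level)
    show "(\<lambda>n. level_sum g n w) summable_on UNIV"
      using summable by (rule norm_summable_imp_summable_on)
  qed simp
  then have "(\<lambda>p. ?f (snd p)) summable_on ?S" by (rule abs_summable_summable)
  then have "((\<lambda>p. ?f (snd p)) has_sum (\<Sum>\<^sub>\<infinity>p\<in>?S. ?f (snd p))) ?S" by (rule has_sum_infsum)
  moreover have "(\<Sum>\<^sub>\<infinity>p\<in>?S. ?f (snd p)) = Zq_word q w"
    unfolding Zq_word_def
    by (rule infsum_reindex_bij_witness[where j = snd and i = "\<lambda>ns. (case ns of [] \<Rightarrow> 0 | m # _ \<Rightarrow> m, ns)"])
       (auto simp: level_def)
  ultimately show ?thesis
    by (simp only:) (erule has_sum_SigmaD, simp add: finite_level has_sum_finiteI sum_level )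
qed

section \<open>\<open>Zq\<close> on \<open>H0hat\<close> as the sum of its top coefficients\<close>

lemma has_sum_Zq_scale:
  assumes "a \<in> H1" "((\<lambda>n. top_coeff q n a) has_sum Zq q a) UNIV"
  shows "((\<lambda>n. top_coeff q n (scal c * a)) has_sum Zq q (scal c * a)) UNIV"
  using has_sum_cmult_right[OF assms(2), of "act q c"]
  by (simp add: top_coeff_def linext_scale Zq_scale assms(1))

lemma has_sum_Zq_add:
  assumes "a \<in> H1" "b \<in> H1"
    and "((\<lambda>n. top_coeff q n a) has_sum Zq q a) UNIV" "((\<lambda>n. top_coeff q n b) has_sum Zq q b) UNIV"
  shows "((\<lambda>n. top_coeff q n (a + b)) has_sum Zq q (a + b)) UNIV"
  using has_sum_add[OF assms(3,4)] by (simp add: top_coeff_def linext_add Zq_add assms(1,2))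

lemma has_sum_Zq_word_elem:
  assumes "norm q < 1" "w = [] \<or> hd w \<noteq> LZ 0"
  shows "((\<lambda>n. top_coeff q n (word_elem w)) has_sum Zq q (word_elem w)) UNIV"
  using Zq_word_has_sum[OF assms] by (simp add: top_coeff_def linext_word_elem Zq_word_elem)

lemma has_sum_Zq_letter_mult:
  assumes "norm q < 1" "l \<noteq> LZ 0" "a \<in> H1"
  shows "((\<lambda>n. top_coeff q n (letter_elem l * a)) has_sum Zq q (letter_elem l * a)) UNIV"
  using assms(3)
proof (induction rule: H1_induct)
  case (word w)
  have "letter_elem l * word_elem w = word_elem (l # w)" by (simp add: word_elem_def)
  then show ?case
    using has_sum_Zq_word_elem[of q "l # w"] assms by (simp only: list.sel) simp
next
  case (scale c a)
  have "letter_elem l * (scal c * a) = scal c * (letter_elem l * a)"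
    by (simp only: mult.assoc[symmetric] scal_commute[of "letter_elem l" c])
  with scale show ?case by (simp only: has_sum_Zq_scale H1_mult letter_elem_H1)
next
  case (add a b)
  then show ?case by (simp only: distrib_left has_sum_Zq_add H1_mult letter_elem_H1)
qed

lemma has_sum_Zq:
  assumes "norm q < 1" "h \<in> H0hat"
  shows "((\<lambda>n. top_coeff q n h) has_sum Zq q h) UNIV"
proof -
  let ?P = "\<lambda>h. h \<in> H1 \<and> ((\<lambda>n. top_coeff q n h) has_sum Zq q h) UNIV"
  obtain c a N b where h: "h = scal c + xi * a + (\<Sum>k = 2..N. zgen k * b k)"
    and a: "a \<in> H1" and b: "\<And>k. b k \<in> H1"
    using assms(2) by (auto simp: H0hat_def)
  have add: "?P (x + y)" if "?P x" "?P y" for x y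
    using that has_sum_Zq_add H1_add by blast
  have scal: "?P (scal c)" for c
    using has_sum_Zq_scale[OF word_elem_H1 has_sum_Zq_word_elem, of q "[]" c] assms(1)
    by (simp add: H1_scal)
  have letter: "?P (letter_elem l * x)" if "l \<noteq> LZ 0" "x \<in> H1" for l x
    using that assms(1) has_sum_Zq_letter_mult H1_mult letter_elem_H1 by blast
  \<comment> \<open>The restriction to subsets of \<open>{2..N}\<close> keeps k \<ge> 2 available,
    so that z_k is never z_1.\<close>
  have "?P (\<Sum>k\<in>S. zgen k * b k)" if "S \<subseteq> {2..N}" for S
    using finite_subset[OF that finite_atLeastAtMost] that
  proof (induction S rule: finite_induct)
    case empty
    show ?case using scal[of 0] by simp
  next
    case (insert k S)
    then have "zgen k = letter_elem (LZ (k - 1))" "LZ (k - 1) \<noteq> LZ 0" by auto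
    with letter b have "?P (zgen k * b k)" by metis
    moreover have "?P (\<Sum>k\<in>S. zgen k * b k)" using insert by simp
    ultimately show ?case
      unfolding sum.insert[OF insert.hyps] by (rule add)
  qed
  then have "?P (\<Sum>k = 2..N. zgen k * b k)" by blast
  moreover have "?P (xi * a)" using letter[of LXi a] a by simp
  ultimately have "?P h" unfolding h using scal add by presburger
  then show ?thesis by blast
qed

subsection \<open>The symmetric double series\<close>

text \<open>A list of pairs \<open>(m, l)\<close> encodes the summation indices \<open>(m\<^sub>i, l\<^sub>i)\<close>, shifted down by one so that
  they range over all natural numbers; \<open>area\<close> is the exponent \<open>\<Sum>\<^sub>i\<^sub>\<le>\<^sub>j m\<^sub>i l\<^sub>j\<close>.\<close>

definition width :: "(nat \<times> nat) list \<Rightarrow> nat"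
  where "width xs = (\<Sum>(m, l)\<leftarrow>xs. Suc m)"

definition height :: "(nat \<times> nat) list \<Rightarrow> nat"
  where "height xs = (\<Sum>(m, l)\<leftarrow>xs. Suc l)"

fun area :: "(nat \<times> nat) list \<Rightarrow> nat" where
  "area [] = 0"
| "area ((m, l) # xs) = Suc m * (Suc l + height xs) + area xs"

lemma height_simps [simp]: "height [] = 0" "height ((m, l) # xs) = Suc l + height xs"
  by (simp_all add: height_def)

text \<open>The double sum is split at its last column instead of its first row; this mirrored
  recursion drives \<open>area_dual\<close>.\<close>

lemma area_snoc: "area (xs @ [(m, l)]) = area xs + Suc l * (Suc m + width xs)"
proof (induction xs rule: area.induct)
  case (2 a b xs)
  have "height (xs @ [(m, l)]) = height xs + Suc l" by (simp add: height_def)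
  with 2 show ?case by (simp add: width_def algebra_simps)
qed (simp add: width_def height_def)

lemma width_dual: "width (rev (map prod.swap xs)) = height xs"
  by (induction xs) (auto simp: width_def height_def)

lemma area_dual: "area (rev (map prod.swap xs)) = area xs"
  by (induction xs rule: area.induct) (simp_all add: area_snoc width_dual)

definition binom_weight :: "(nat \<times> nat) list \<Rightarrow> (nat \<times> nat) list \<Rightarrow> nat"
  where "binom_weight ps xs = (\<Prod>((a, b), (m, l))\<leftarrow>zip ps xs. (m choose a) * (l choose b))"

lemma binom_weight_simps [simp]:
  "binom_weight [] xs = 1"
  "binom_weight ((a, b) # ps) ((m, l) # xs) = (m choose a) * (l choose b) * binom_weight ps xs"
  by (simp_all add: binom_weight_def)

text \<open>Each factor is unchanged when both of its pairs are swapped, and the order of the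
  factors is immaterial. Equal lengths make \<open>zip\<close> commute with reversal.\<close>

lemma binom_weight_dual:
  assumes "length ps = length xs"
  shows "binom_weight (rev (map prod.swap ps)) (rev (map prod.swap xs)) = binom_weight ps xs"
proof -
  let ?f = "\<lambda>((a, b), (m, l)). (m choose a) * (l choose b)"
  have "prod_list (map ?f (rev zs)) = prod_list (map ?f zs)" for zs
    by (induction zs) (simp_all add: mult.commute)
  moreover have "zip (rev (map prod.swap ps)) (rev (map prod.swap xs))
      = rev (map (map_prod prod.swap prod.swap) (zip ps xs))"
    using assms by (simp add: zip_rev zip_map_map map_prod_def)
  moreover have "?f \<circ> map_prod prod.swap prod.swap = ?f" by (auto simp: fun_eq_iff)
  ultimately show ?thesis by (simp add: binom_weight_def)
qed

definition dual_series :: "complex \<Rightarrow> (nat \<times> nat) list \<Rightarrow> complex"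
  where "dual_series q ps =
    (\<Sum>\<^sub>\<infinity>xs\<in>{xs. length xs = length ps}. of_nat (binom_weight ps xs) * q ^ area xs)"

text \<open>The duality is a change of summation variable along the involution \<open>?d\<close>,
  which preserves the area and carries one binomial weight into the other.\<close>

lemma dual_series_dual: "dual_series q (rev (map prod.swap ps)) = dual_series q ps"
proof -
  let ?d = "\<lambda>xs. rev (map prod.swap xs)"
  have dd: "?d (?d xs) = xs" for xs :: "(nat \<times> nat) list"
    by (simp add: rev_map)
  have eq: "of_nat (binom_weight ps (?d xs)) * q ^ area (?d xs)
      = of_nat (binom_weight (?d ps) xs) * q ^ area xs"
    if "length xs = length (?d ps)" for xs
    using binom_weight_dual[of ps "?d xs"] that by (simp only: dd area_dual) simp
  show ?thesis
    unfolding dual_series_def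
    by (rule infsum_reindex_bij_witness[where i = ?d and j = ?d]) (simp_all only: dd eq mem_Collect_eq, simp_all)
qed

text \<open>The top coefficient of the product with all powers of 1 - q removed. The binomial
  coefficient counts the positions of the b indices of \<rho>^b, lying strictly between k and
  n.\<close>

fun level_series :: "complex \<Rightarrow> (nat \<times> nat) list \<Rightarrow> nat \<Rightarrow> complex" where
  "level_series q [] n = (if n = 0 then 1 else 0)"
| "level_series q ((a, b) # ps) n = (if n = 0 then 0 else
     (q ^ n / (1 - q ^ n)) ^ Suc a * (\<Sum>k<n. of_nat ((n - 1 - k) choose b) * level_series q ps k))"

lemma has_sum_sum_Sigma:
  fixes f :: "'a \<times> 'b \<Rightarrow> 'c :: real_normed_vector"
  assumes "finite A" "\<And>x. x \<in> A \<Longrightarrow> ((\<lambda>y. f (x, y)) has_sum g x) (B x)"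
  shows "(f has_sum (\<Sum>x\<in>A. g x)) (Sigma A B)"
  using assms
proof (induction A rule: finite_induct)
  case (insert x A)
  have "(f has_sum g x) (Pair x ` B x)"
    using insert.prems[of x] by (subst has_sum_reindex) (auto simp: inj_on_def o_def)
  then have "(f has_sum (g x + (\<Sum>x\<in>A. g x))) (Pair x ` B x \<union> Sigma A B)"
    using insert by (intro has_sum_Un_disjoint) auto
  moreover have "Pair x ` B x \<union> Sigma A B = Sigma (insert x A) B" by auto
  ultimately show ?case using insert.hyps by simp
qed simp

lemma summable_on_product_nonneg:
  fixes f :: "'a \<Rightarrow> real" and g :: "'b \<Rightarrow> real"
  assumes "f summable_on A" "g summable_on B"
    and "\<And>x. x \<in> A \<Longrightarrow> 0 \<le> f x" "\<And>y. y \<in> B \<Longrightarrow> 0 \<le> g y"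
  shows "(\<lambda>(x, y). f x * g y) summable_on A \<times> B"
  using assms
  by (intro summable_on_SigmaI[where g = "\<lambda>x. f x * infsum g B"] summable_on_cmult_left)
     (auto intro: has_sum_cmult_right)

text \<open>Over the complex numbers summability is absolute, so the products of norms majorise the
  double family.\<close>

lemma has_sum_product:
  fixes f :: "'a \<Rightarrow> complex" and g :: "'b \<Rightarrow> complex"
  assumes "(f has_sum s) A" "(g has_sum t) B"
  shows "((\<lambda>(x, y). f x * g y) has_sum (s * t)) (A \<times> B)"
proof (rule has_sum_SigmaI)
  show "((\<lambda>y. case (x, y) of (x, y) \<Rightarrow> f x * g y) has_sum (f x * t)) B" for x
    using assms(2) by (simp add: has_sum_cmult_right)
  show "((\<lambda>x. f x * t) has_sum (s * t)) A"
    using assms(1) by (rule has_sum_cmult_left)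
  have "(\<lambda>x. norm (f x)) summable_on A" "(\<lambda>x. norm (g x)) summable_on B"
    using assms by (auto simp: summable_on_iff_abs_summable_on_complex[symmetric] summable_on_def)
  then have "(\<lambda>(x, y). norm (f x) * norm (g y)) summable_on (A \<times> B)"
    by (rule summable_on_product_nonneg) auto
  then have "(\<lambda>p. norm (case p of (x, y) \<Rightarrow> f x * g y)) summable_on (A \<times> B)"
    by (simp add: case_prod_unfold norm_mult)
  then show "(\<lambda>(x, y). f x * g y) summable_on (A \<times> B)" by (rule abs_summable_summable)
qed

text \<open>Fixing the height n makes the first l a function of the height k of the tail, while m
  stays free. Its contribution to the area is \<open>Suc m * n\<close>, so the sum over m is a
  binomial series in q^n.\<close>

lemma level_series_has_sum:
  assumes "norm q < 1"
  shows "((\<lambda>xs. of_nat (binom_weight ps xs) * q ^ area xs) has_sum level_series q ps n)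
    {xs. length xs = length ps \<and> height xs = n}"
proof (induction ps arbitrary: n)
  case Nil
  have "{xs. length xs = length [] \<and> height xs = n} = (if n = 0 then {[]} else {})" by auto
  then show ?case by (simp add: has_sum_finiteI)
next
  case (Cons p ps)
  obtain a b where p: "p = (a, b)" by (cases p)
  let ?X = "\<lambda>n. {xs. length xs = length (p # ps) \<and> height xs = n}"
  let ?Y = "\<lambda>k. {xs. length xs = length ps \<and> height xs = k}"
  let ?t = "\<lambda>ps xs. of_nat (binom_weight ps xs) * q ^ area xs"
  show ?case
  proof (cases "n = 0")
    case True
    \<comment> \<open>Every pair adds at least 1 to the height, so no nonempty list has height
      0.\<close>
    have X: "?X n = {}" using True by (auto simp: length_Suc_conv)
    show ?thesis unfolding X using True by (simp add: p)
  next
    case False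
    have "norm (q ^ n) < 1"
      using assms False by (simp add: norm_power power_less_one_iff)
    note s = choose_power_series[OF this, of a]
    have m: "((\<lambda>m. q ^ n * (of_nat (m choose a) * (q ^ n) ^ m)) has_sum (q ^ n / (1 - q ^ n)) ^ Suc a) UNIV"
      using has_sum_cmult_right[OF norm_summable_imp_has_sum[OF s(2,1)], of "q ^ n"]
      by (simp add: power_divide)
    have "((\<lambda>(k, xs). of_nat ((n - 1 - k) choose b) * ?t ps xs) has_sum
        (\<Sum>k<n. of_nat ((n - 1 - k) choose b) * level_series q ps k)) (SIGMA k:{..<n}. ?Y k)"
      by (rule has_sum_sum_Sigma) (simp_all only: prod.case finite_lessThan has_sum_cmult_right[OF Cons.IH])
    from has_sum_product[OF m this]
    have "((\<lambda>(m, (k, xs)). q ^ n * (of_nat (m choose a) * (q ^ n) ^ m) *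
          (of_nat ((n - 1 - k) choose b) * ?t ps xs)) has_sum level_series q (p # ps) n)
        (UNIV \<times> (SIGMA k:{..<n}. ?Y k))"
      using False by (simp add: p case_prod_unfold)
    \<comment> \<open>From \<open>Suc l + k = n\<close> the missing entry is
      \<open>l = n - 1 - k\<close>; conversely k is read off as the height of the tail.\<close>
    also have "?this \<longleftrightarrow> ((?t (p # ps)) has_sum level_series q (p # ps) n) (?X n)"
    proof (rule has_sum_reindex_bij_witness[where j = "\<lambda>(m, k, xs). (m, n - 1 - k) # xs"
          and i = "\<lambda>xs. (fst (hd xs), height (tl xs), tl xs)"])
      fix xs assume "xs \<in> ?X n"
      then obtain m l ys where xs: "xs = (m, l) # ys" "length ys = length ps" "Suc (l + height ys) = n"
        by (auto simp: length_Suc_conv)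
      then show "(case (fst (hd xs), height (tl xs), tl xs) of (m, k, xs) \<Rightarrow> (m, n - 1 - k) # xs) = xs"
        and "(fst (hd xs), height (tl xs), tl xs) \<in> UNIV \<times> (SIGMA k:{..<n}. ?Y k)"
        by auto
    next
      fix z :: "nat \<times> nat \<times> (nat \<times> nat) list"
      assume "z \<in> UNIV \<times> (SIGMA k:{..<n}. ?Y k)"
      then obtain m xs where z: "z = (m, height xs, xs)" "height xs < n" "length xs = length ps" by auto
      then show "(fst (hd (case z of (m, k, xs) \<Rightarrow> (m, n - 1 - k) # xs)),
           height (tl (case z of (m, k, xs) \<Rightarrow> (m, n - 1 - k) # xs)),
           tl (case z of (m, k, xs) \<Rightarrow> (m, n - 1 - k) # xs)) = z"
        and "(case z of (m, k, xs) \<Rightarrow> (m, n - 1 - k) # xs) \<in> ?X n"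
        by auto
      have "area ((m, n - 1 - height xs) # xs) = n + n * m + area xs"
        using z(2) by simp
      then show "?t (p # ps) (case z of (m, k, xs) \<Rightarrow> (m, n - 1 - k) # xs) =
          (case z of (m, k, xs) \<Rightarrow> q ^ n * (of_nat (m choose a) * (q ^ n) ^ m) *
          (of_nat ((n - 1 - k) choose b) * ?t ps xs))"
        by (simp add: z p power_add mult_ac flip: power_mult del: area.simps)
    qed simp
    finally show ?thesis .
  qed
qed

text \<open>The first pair adds at least m + l to the area, so the terms are dominated by a product
  of one-variable binomial series and the series for the tail.\<close>

lemma summable_binom_weight_area:
  fixes t :: real
  assumes "0 \<le> t" "t < 1"
  shows "(\<lambda>xs. real (binom_weight ps xs) * t ^ area xs) summable_on {xs. length xs = length ps}"
proof (induction ps)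
  case Nil
  then show ?case by simp
next
  case (Cons p ps)
  obtain a b where p: "p = (a, b)" by (cases p)
  let ?c = "\<lambda>a m. real (m choose a) * t ^ m"
  let ?X = "{xs. length xs = length ps}"
  let ?g = "\<lambda>((m, l), xs). ?c a m * ?c b l * (real (binom_weight ps xs) * t ^ area xs)"
  have c: "?c a summable_on UNIV" for a
    using choose_power_norm_summable[of t a] assms by (intro norm_summable_imp_summable_on) simp
  have "(\<lambda>(m, l). ?c a m * ?c b l) summable_on UNIV \<times> UNIV"
    using assms by (intro summable_on_product_nonneg c) auto
  then have "(\<lambda>(z, xs). (case z of (m, l) \<Rightarrow> ?c a m * ?c b l) * (real (binom_weight ps xs) * t ^ area xs))
      summable_on (UNIV \<times> UNIV) \<times> ?X"
    by (rule summable_on_product_nonneg[OF _ Cons.IH]) (use assms in auto)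
  then have g: "?g summable_on UNIV \<times> ?X"
    by (simp add: case_prod_unfold)
  have "(\<lambda>(z, xs). real (binom_weight (p # ps) (z # xs)) * t ^ area (z # xs)) summable_on UNIV \<times> ?X"
  proof (rule summable_on_comparison_test[OF g]; clarify)
    fix m l xs
    have "t ^ area ((m, l) # xs) \<le> t ^ (m + l + area xs)"
      using assms by (intro power_decreasing) auto
    then show "real (binom_weight (p # ps) ((m, l) # xs)) * t ^ area ((m, l) # xs)
        \<le> ?c a m * ?c b l * (real (binom_weight ps xs) * t ^ area xs)"
    proof -
      have "real (binom_weight (p # ps) ((m, l) # xs)) * t ^ area ((m, l) # xs)
          \<le> real (binom_weight (p # ps) ((m, l) # xs)) * t ^ (m + l + area xs)"
        by (rule mult_left_mono) (use \<open>t ^ area ((m, l) # xs) \<le> _\<close> in auto)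
      then show ?thesis
        by (simp only: p power_add binom_weight_simps of_nat_mult mult_ac)
    qed
  qed (use assms in auto)
  also have "?this \<longleftrightarrow> ?case"
    by (rule summable_on_reindex_bij_witness[where j = "\<lambda>(z, xs). z # xs" and i = "\<lambda>xs. (hd xs, tl xs)"])
       (auto simp: length_Suc_conv simp del: area.simps)
  finally show ?case .
qed

text \<open>The height is the largest original index n_1 = l_1 + ... + l_r; the absolutely
  convergent double series is regrouped by it.\<close>

lemma level_series_has_sum_dual_series:
  assumes "norm q < 1"
  shows "(level_series q ps has_sum dual_series q ps) UNIV"
proof -
  let ?t = "\<lambda>xs. of_nat (binom_weight ps xs) * q ^ area xs"
  let ?X = "\<lambda>n. {xs. length xs = length ps \<and> height xs = n}"
  have "(\<lambda>xs. norm (?t xs)) summable_on {xs. length xs = length ps}"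
    using summable_binom_weight_area[of "norm q" ps] assms by (simp add: norm_mult norm_power)
  then have "(?t has_sum dual_series q ps) {xs. length xs = length ps}"
    unfolding dual_series_def by (rule has_sum_infsum[OF abs_summable_summable])
  also have "?this \<longleftrightarrow> ((\<lambda>p. ?t (snd p)) has_sum dual_series q ps) (SIGMA n:UNIV. ?X n)"
    by (rule has_sum_reindex_bij_witness[where j = "\<lambda>xs. (height xs, xs)" and i = snd]) auto
  finally show ?thesis
    by (rule has_sum_SigmaD) (simp add: level_series_has_sum[OF assms])
qed

subsection \<open>The duality\<close>

definition phi_rho_prod :: "(nat \<times> nat) list \<Rightarrow> alg"
  where "phi_rho_prod ps = prod_list (map (\<lambda>(a, b). phi (a + 1) * rho ^ b) ps)"

definition weight :: "(nat \<times> nat) list \<Rightarrow> nat"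
  where "weight ps = (\<Sum>(a, b)\<leftarrow>ps. Suc a + b)"

lemma phi_rho_prod_H0hat: "ps \<noteq> [] \<Longrightarrow> phi_rho_prod ps \<in> H0hat"
  using phi_rho_product_H0hat[of ps fst snd] by (simp add: phi_rho_prod_def case_prod_unfold)

lemma phi_rho_prod_H1: "phi_rho_prod ps \<in> H1"
  using phi_rho_prod_H0hat[of ps] H0hat_subset_H1
  by (cases "ps = []") (auto simp: phi_rho_prod_def)

lemma homogeneous_phi_rho_prod: "homogeneous (weight ps) (phi_rho_prod ps)"
proof (induction ps)
  case Nil
  then show ?case by (simp add: weight_def phi_rho_prod_def homogeneous_1)
next
  case (Cons p ps)
  obtain a b where p: "p = (a, b)" by (cases p)
  have "homogeneous (a + 1 + b * 1 + weight ps) (phi (a + 1) * rho ^ b * phi_rho_prod ps)"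
    by (intro homogeneous_mult homogeneous_phi homogeneous_power homogeneous_rho Cons) simp
  then show ?case by (simp add: p weight_def phi_rho_prod_def)
qed

text \<open>Each \<rho> contributes 1 - q and one index, and b indices fit strictly between k and n
  in \<open>(n - 1 - k) choose b\<close> ways. The proof is a double induction on b and n using
  Pascal's rule.\<close>

lemma sum_top_coeff_rho_power_mult:
  assumes "norm q < 1" "h \<in> H1"
  shows "(\<Sum>k<n. top_coeff q k (rho ^ b * h))
    = (1 - q) ^ b * (\<Sum>k<n. of_nat ((n - 1 - k) choose b) * top_coeff q k h)"
proof (induction b arbitrary: n)
  case 0
  then show ?case by simp
next
  case (Suc b)
  note IH = Suc.IH
  show ?case
  proof (induction n)
    case (Suc n)
    let ?t = "\<lambda>k. top_coeff q k h"
    have "top_coeff q n (rho ^ Suc b * h) = (1 - q) * (\<Sum>k<n. top_coeff q k (rho ^ b * h))"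
      using top_coeff_rho_mult[OF assms(1) H1_mult[OF H1_power[OF rho_H1] assms(2)], of n b]
      by (cases "n = 0") (simp_all add: mult.assoc)
    also have "\<dots> = (1 - q) ^ Suc b * (\<Sum>k<n. of_nat ((n - 1 - k) choose b) * ?t k)"
      by (simp only: IH power_Suc mult.assoc)
    finally have "(\<Sum>k<Suc n. top_coeff q k (rho ^ Suc b * h)) = (1 - q) ^ Suc b *
        (\<Sum>k<n. of_nat ((n - 1 - k) choose Suc b) * ?t k + of_nat ((n - 1 - k) choose b) * ?t k)"
      using Suc.IH by (simp add: sum.distrib distrib_left)
    also have "(\<Sum>k<n. of_nat ((n - 1 - k) choose Suc b) * ?t k + of_nat ((n - 1 - k) choose b) * ?t k)
        = (\<Sum>k<n. of_nat ((n - k) choose Suc b) * ?t k)"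
    proof (rule sum.cong)
      fix k assume "k \<in> {..<n}"
      then have "k < n" by simp
      then have "\<exists>j. n - k = Suc j \<and> n - 1 - k = j" by presburger
      then obtain j where j: "n - k = Suc j" "n - 1 - k = j" by blast
      show "of_nat ((n - 1 - k) choose Suc b) * ?t k + of_nat ((n - 1 - k) choose b) * ?t k
          = of_nat ((n - k) choose Suc b) * ?t k"
        unfolding j by (simp add: algebra_simps)
    qed simp
    \<comment> \<open>The new term k = n vanishes, because
      \<open>0 choose Suc b = 0\<close>.\<close>
    also have "\<dots> = (\<Sum>k<Suc n. of_nat ((Suc n - 1 - k) choose Suc b) * ?t k)" by simp
    finally show ?case .
  qed simp
qed

text \<open>A factor \<phi>_{a+1} yields (1 - q)^{a+1} and each \<rho> yields 1 - q, so the total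
  exponent is the weight.\<close>

lemma top_coeff_phi_rho_prod:
  assumes "norm q < 1"
  shows "top_coeff q n (phi_rho_prod ps) = (1 - q) ^ weight ps * level_series q ps n"
proof (induction ps arbitrary: n)
  case Nil
  then show ?case by (simp add: phi_rho_prod_def weight_def top_coeff_1)
next
  case (Cons p ps)
  obtain a b where p: "p = (a, b)" by (cases p)
  have "phi_rho_prod (p # ps) = phi (Suc a) * (rho ^ b * phi_rho_prod ps)"
    by (simp add: phi_rho_prod_def p mult.assoc)
  moreover have "rho ^ b * phi_rho_prod ps \<in> H1"
    by (intro H1_mult H1_power rho_H1 phi_rho_prod_H1)
  ultimately have "top_coeff q n (phi_rho_prod (p # ps)) = (if n = 0 then 0 else
      (1 - q) ^ Suc a * (q ^ n / (1 - q ^ n)) ^ Suc a *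
      ((1 - q) ^ b * (\<Sum>k<n. of_nat ((n - 1 - k) choose b) * top_coeff q k (phi_rho_prod ps))))"
    by (simp only: top_coeff_phi_mult[OF assms] sum_top_coeff_rho_power_mult[OF assms phi_rho_prod_H1])
  also have "(\<Sum>k<n. of_nat ((n - 1 - k) choose b) * top_coeff q k (phi_rho_prod ps))
      = (1 - q) ^ weight ps * (\<Sum>k<n. of_nat ((n - 1 - k) choose b) * level_series q ps k)"
    by (simp add: Cons sum_distrib_left mult.left_commute)
  also have "weight (p # ps) = Suc a + b + weight ps"
    by (simp add: weight_def p)
  then have "(if n = 0 then 0 else (1 - q) ^ Suc a * (q ^ n / (1 - q ^ n)) ^ Suc a *
      ((1 - q) ^ b * ((1 - q) ^ weight ps * (\<Sum>k<n. of_nat ((n - 1 - k) choose b) * level_series q ps k))))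
      = (1 - q) ^ weight (p # ps) * level_series q (p # ps) n"
    by (simp add: p power_add mult_ac)
  finally show ?case .
qed

text \<open>The product is homogeneous of degree \<open>weight ps\<close>, so the normalisation in
  \<open>Zq_bar\<close> cancels exactly the power of 1 - q just collected.\<close>

lemma Zq_bar_phi_rho_prod:
  assumes "norm q < 1" "ps \<noteq> []"
  shows "Zq_bar q (phi_rho_prod ps) = dual_series q ps"
proof -
  have "((\<lambda>n. (1 - q) ^ weight ps * level_series q ps n) has_sum Zq q (phi_rho_prod ps)) UNIV"
    using has_sum_Zq[OF assms(1) phi_rho_prod_H0hat[OF assms(2)]]
    by (simp add: top_coeff_phi_rho_prod[OF assms(1)])
  moreover have "((\<lambda>n. (1 - q) ^ weight ps * level_series q ps n) has_sum
      (1 - q) ^ weight ps * dual_series q ps) UNIV"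
    by (intro has_sum_cmult_right level_series_has_sum_dual_series assms)
  ultimately have "Zq q (phi_rho_prod ps) = (1 - q) ^ weight ps * dual_series q ps"
    by (rule has_sum_unique)
  moreover have "1 - q \<noteq> 0" using assms by auto
  ultimately show ?thesis
    by (simp add: Zq_bar_homogeneous[OF homogeneous_phi_rho_prod])
qed

theorem theorem4:
  fixes q :: complex and r :: nat and \<alpha> \<beta> :: "nat \<Rightarrow> nat"
  assumes "0 < norm q" and "norm q < 1" and "r \<ge> 1"
  shows "Zq_bar q (prod_list (map (\<lambda>i. phi (\<alpha> i + 1) * rho ^ \<beta> i) [1..<Suc r]))
       = Zq_bar q (prod_list (map (\<lambda>i. phi (\<beta> i + 1) * rho ^ \<alpha> i) (rev [1..<Suc r])))"
proof -
  \<comment> \<open>Swapping the entries of these pairs and reversing the list gives the exponents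
    of the right-hand side.\<close>
  let ?ps = "map (\<lambda>i. (\<alpha> i, \<beta> i)) [1..<Suc r]"
  have ne: "?ps \<noteq> []" using assms by simp
  have "prod_list (map (\<lambda>i. phi (\<alpha> i + 1) * rho ^ \<beta> i) [1..<Suc r]) = phi_rho_prod ?ps"
    by (simp add: phi_rho_prod_def o_def del: upt_Suc)
  moreover have "prod_list (map (\<lambda>i. phi (\<beta> i + 1) * rho ^ \<alpha> i) (rev [1..<Suc r]))
      = phi_rho_prod (rev (map prod.swap ?ps))"
    by (simp add: phi_rho_prod_def o_def rev_map del: upt_Suc)
  ultimately show ?thesis
    using Zq_bar_phi_rho_prod[OF assms(2)] ne dual_series_dual[of q ?ps]
    by (simp only:) (simp del: upt_Suc)
qed

end
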